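(* For every $b\in\mathbb{Z}_+$ there is $k=k(b)\in\mathbb{Z}_+$ such that, if $A\subset\mathbb{Z}$ is any finite set with $|A|=N\ge 2$, then either $$|kA|>N^b \quad\text{or}\quad |A^{(k)}|>N^b .$$
   Context: $|\cdot|$ denotes cardinality and $\mathbb{Z}_+$ the positive integers. For a finite set $A\subset\mathbb{Z}$ and $k\in\mathbb{Z}_+$: $kA=A+\cdots+A=\{a_1+\cdots+a_k : a_i\in A\}$ is the $k$-fold sumset, and $A^{(k)}=A\times\cdots\times A=\{a_1a_2\cdots a_k : a_i\in A\}$ is the $k$-fold product set (a set of integers). The $a_i$ need not be distinct. *)

theory Defs
  imports Complex_Main
begin

definition kfold_sumset :: "nat \<Rightarrow> int set \<Rightarrow> int set" where
  "kfold_sumset k A = {(\<Sum>i<k. a i) | a :: nat \<Rightarrow> int. \<forall>i<k. a i \<in> A}"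

definition kfold_prodset :: "nat \<Rightarrow> int set \<Rightarrow> int set" where
  "kfold_prodset k A = {(\<Prod>i<k. a i) | a :: nat \<Rightarrow> int. \<forall>i<k. a i \<in> A}"

end

theory Submission
  imports Defs "HOL-Library.Set_Algebras" "HOL-Library.FuncSet"
    "HOL-Computational_Algebra.Primes" "HOL-Analysis.Convex"
begin

text \<open>
  The theorem is due to Bourgain and Chang; the proof follows the later approach of Palvolgyi and
  Zhelezov. Suppose that \<open>A\<close> consists of \<open>N\<close> positive integers and that \<open>A ^ (2 ^ J)\<close> has at most
  \<open>N ^ b\<close> elements. The sizes of \<open>A, A ^ 2, A ^ 4, \<dots>\<close> cannot all grow by a factor \<open>N powr (b / J)\<close>, so
  some \<open>B = A ^ (2 ^ j)\<close> has the very small doubling \<open>card (B * B) \<le> N powr (b / J) * card B\<close>. Such a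
  \<open>B\<close> contains a large subset \<open>S\<close> whose additive energies, and those of all its subsets, are almost as
  small as they can be (\<open>large_structured_subset\<close>). There are few ratios between \<open>A\<close> and \<open>S\<close>
  (\<open>card_ratios_triangle\<close>, \<open>card_ratios_le\<close>), so one dilate of \<open>S\<close> contains at least \<open>N powr (3/4)\<close> elements of \<open>A\<close>,
  and by Cauchy-Schwarz (\<open>card_power_le_sums_energy\<close>) the sums of these elements alone already outnumber
  \<open>N ^ b\<close>.

  Both halves of the construction of \<open>S\<close> split a set into its fibers over the \<open>p\<close>-adic valuation, one
  prime \<open>p\<close> at a time.

  Additively: in a solution of \<open>x\<^sub>1 + \<dots> + x\<^sub>k = y\<^sub>1 + \<dots> + y\<^sub>k\<close> the smallest \<open>p\<close>-adic valuation occurs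
  at least twice. With a Hoelder-type estimate this shows that a union of \<open>p\<close>-fibers has energies worse
  than those of the fibers by a factor \<open>4 k\<^sup>2\<close> only (\<open>energy_le_of_fibers\<close>). If a set \<open>X\<close> is allowed the
  energy bound \<open>card X powr \<delta>\<close>, this loss is paid for as soon as each fiber is smaller than \<open>X\<close> by the
  constant factor \<open>H\<close> with \<open>H powr \<delta> = 4 k\<^sup>2\<close>. Hence the largest size \<open>f X\<close> of a subset of \<open>X\<close>
  obeying this bound satisfies \<open>f X\<^sub>i \<le> f X\<close> for each fiber \<open>X\<^sub>i\<close>, and \<open>(\<Sum>i. f X\<^sub>i) \<le> (1 + H) * f X\<close>:
  subsets of the small fibers are united, and there are at most \<open>H\<close> large fibers.

  Multiplicatively: these two properties of \<open>f\<close> are all that is needed to show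
  \<open>card (X * Y) \<ge> sqrt (w X * w Y)\<close> for the weight \<open>w X = card X powr (1 + s) * f X powr - s\<close> with a small
  constant \<open>s\<close> (\<open>card_product_ge_weight\<close>). In the induction over the primes the valuations of the product
  form a sumset of valuations, and the bound is inherited from the fibers by a discrete form of the
  Prekopa-Leindler inequality. For \<open>X = Y = B\<close> it says that small doubling makes \<open>f B\<close> large.
\<close>

section \<open>A discrete Prekopa-Leindler inequality\<close>

text \<open>
  Adding all of \<open>J\<close> to the least element of \<open>I\<close>, and then all of \<open>I\<close> to the greatest element of
  \<open>J\<close>, never repeats a value except at the turning point.
\<close>
lemma card_set_plus_ge:
  fixes I J :: "nat set"
  assumes "finite I" "finite J" "I \<noteq> {}" "J \<noteq> {}"
  shows "card I + card J \<le> card (I + J) + 1"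
proof -
  define U where "U = (\<lambda>j. Min I + j) ` J"
  define V where "V = (\<lambda>i. i + Max J) ` I"
  have "U \<inter> V \<subseteq> {Min I + Max J}"
  proof
    fix z assume "z \<in> U \<inter> V"
    then obtain i j where "i \<in> I" "j \<in> J" "z = Min I + j" "z = i + Max J"
      unfolding U_def V_def by auto
    moreover from this assms have "j \<le> Max J" "Min I \<le> i" by auto
    ultimately show "z \<in> {Min I + Max J}" by auto
  qed
  then have "card (U \<inter> V) \<le> 1" using card_mono[of "{Min I + Max J}" "U \<inter> V"] by simp
  moreover have "card U = card J" "card V = card I"
    unfolding U_def V_def by (auto intro!: card_image inj_onI)
  moreover have "card (U \<union> V) \<le> card (I + J)"
    using assms by (intro card_mono) (auto simp: U_def V_def intro!: set_plus_intro finite_set_plus Min_in Max_in)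
  moreover have "card U + card V = card (U \<union> V) + card (U \<inter> V)"
    by (rule card_Un_Int) (auto simp: U_def V_def assms)
  ultimately show ?thesis by linarith
qed

text \<open>
  By layers: at each height \<open>h < c\<close> the superlevel set of \<open>g\<close> contains the sum of the superlevel sets
  of \<open>p\<close> and \<open>q\<close>, which are nonempty because both maxima equal \<open>c\<close>, and \<open>card_set_plus_ge\<close> applies.
  Integrating over \<open>h\<close> gives the claim. The induction peels off one layer, of height the least value,
  at a time.
\<close>
lemma sum_sumset_ge:
  fixes p q g :: "nat \<Rightarrow> real" and I J :: "nat set"
  assumes "finite I" "finite J"
    and "i0 \<in> I" "p i0 = c" "\<And>i. i \<in> I \<Longrightarrow> 0 \<le> p i \<and> p i \<le> c"
    and "j0 \<in> J" "q j0 = c" "\<And>j. j \<in> J \<Longrightarrow> 0 \<le> q j \<and> q j \<le> c"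
    and "\<And>i j. i \<in> I \<Longrightarrow> j \<in> J \<Longrightarrow> min (p i) (q j) \<le> g (i + j)"
  shows "sum p I + sum q J - c \<le> sum g (I + J)"
  using assms
proof (induction "card I + card J" arbitrary: I J p q g c rule: less_induct)
  case less
  define t where "t = Min (p ` I \<union> q ` J)"
  have fin: "finite (p ` I \<union> q ` J)" "p ` I \<union> q ` J \<noteq> {}" using less.prems by auto
  have tle: "t \<le> p i" if "i \<in> I" for i unfolding t_def using fin that by auto
  have tle': "t \<le> q j" if "j \<in> J" for j unfolding t_def using fin that by auto
  have tin: "t \<in> p ` I \<union> q ` J" unfolding t_def by (rule Min_in[OF fin])
  have t0: "0 \<le> t" using tin less.prems(5,8) by auto
  have gt: "t \<le> g k" if "k \<in> I + J" for k
    using that less.prems(9) tle tle' by (fastforce simp: set_plus_def)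
  have cardge: "card I + card J \<le> card (I + J) + 1"
    using less.prems by (intro card_set_plus_ge) auto
  have tc: "t \<le> c" using tle[OF less.prems(3)] less.prems(4) by simp
  have finIJ: "finite (I + J)" using less.prems by (intro finite_set_plus)
  define G where "G = (\<lambda>k. g k - t)"
  define P where "P = (\<lambda>i. p i - t)"
  define Q where "Q = (\<lambda>j. q j - t)"
  have eqs: "sum p I = sum P I + t * card I" "sum q J = sum Q J + t * card J"
    "sum g (I + J) = sum G (I + J) + t * card (I + J)"
    unfolding P_def Q_def G_def by (simp_all add: sum_subtractf)
  have tcard: "t * card I + t * card J \<le> t * card (I + J) + t"
  proof -
    have "t * (real (card I) + real (card J)) \<le> t * (real (card (I + J)) + 1)"
      using cardge t0 by (intro mult_left_mono) (simp_all flip: of_nat_add)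
    then show ?thesis by (simp add: algebra_simps)
  qed
  have "sum P I + sum Q J - (c - t) \<le> sum G (I + J)"
  proof (cases "t = c")
    case True
    have "p i = c" if "i \<in> I" for i using tle[OF that] less.prems(5)[OF that] True by simp
    moreover have "q j = c" if "j \<in> J" for j using tle'[OF that] less.prems(8)[OF that] True by simp
    ultimately have "sum P I = 0" "sum Q J = 0" unfolding P_def Q_def using True by auto
    moreover have "0 \<le> sum G (I + J)" using gt by (auto intro: sum_nonneg simp: G_def)
    ultimately show ?thesis using True by simp
  next
    case False
    define I' where "I' = {i \<in> I. P i > 0}"
    define J' where "J' = {j \<in> J. Q j > 0}"
    have sub: "I' \<subseteq> I" "J' \<subseteq> J" unfolding I'_def J'_def by auto
    have "I' \<noteq> I \<or> J' \<noteq> J" using tin unfolding I'_def J'_def P_def Q_def by auto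
    then have lt: "card I' + card J' < card I + card J"
      using less.prems(1,2) sub psubset_card_mono[of I I'] psubset_card_mono[of J J']
        card_mono[of I I'] card_mono[of J J'] by (metis add_le_less_mono add_less_le_mono psubsetI)
    have "sum P I' + sum Q J' - (c - t) \<le> sum G (I' + J')"
    proof (rule less.hyps[OF lt])
      show "i0 \<in> I'" "j0 \<in> J'" using less.prems False tc by (auto simp: I'_def J'_def P_def Q_def)
      show "P i0 = c - t" "Q j0 = c - t" using less.prems by (auto simp: P_def Q_def)
      show "min (P i) (Q j) \<le> G (i + j)" if "i \<in> I'" "j \<in> J'" for i j
        using less.prems(9)[of i j] that unfolding I'_def J'_def P_def Q_def G_def by auto
    qed (use less.prems in \<open>auto simp: I'_def J'_def P_def Q_def\<close>)
    moreover have "sum P I' = sum P I" "sum Q J' = sum Q J"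
      using tle tle' less.prems(1,2) by (auto intro!: sum.mono_neutral_left simp: I'_def J'_def P_def Q_def) (metis order_le_less)+
    moreover have "sum G (I' + J') \<le> sum G (I + J)"
      using sub finIJ gt by (intro sum_mono2) (auto simp: G_def set_plus_mono2)
    ultimately show ?thesis by simp
  qed
  then show ?case using eqs tcard by simp
qed

text \<open>
  In the application \<open>a i\<close> and \<open>c j\<close> are weights of fibers and \<open>g k\<close> is the size of a fiber of the
  product set. The first bound is strong when neither \<open>a\<close> nor \<open>c\<close> is concentrated on its largest value.
  If both are, it loses too much, and the other two, which only use a single row \<open>I + {l}\<close> or
  \<open>{m} + J\<close>, are better: there a small remainder \<open>\<epsilon>\<close> enters through \<open>sqrt \<epsilon>\<close>.
\<close>
lemma sumset_weight_bounds:
  fixes a c g :: "nat \<Rightarrow> real" and I J :: "nat set"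
  assumes fin: "finite I" "finite J"
    and a: "\<And>i. i \<in> I \<Longrightarrow> 0 < a i \<and> a i \<le> a m" "m \<in> I"
    and c: "\<And>j. j \<in> J \<Longrightarrow> 0 < c j \<and> c j \<le> c l" "l \<in> J"
    and g: "\<And>i j. i \<in> I \<Longrightarrow> j \<in> J \<Longrightarrow> sqrt (a i * c j) \<le> g (i + j)"
  shows "sqrt (a m * c l) * (sum a I / a m + sum c J / c l - 1) \<le> sum g (I + J)"
    and "sqrt (c l) * (sqrt (a m) + sqrt (sum a (I - {m}))) \<le> sum g (I + J)"
    and "sqrt (a m) * (sqrt (c l) + sqrt (sum c (J - {l}))) \<le> sum g (I + J)"
proof -
  define R where "R = sqrt (a m * c l)"
  have pos: "0 < a m" "0 < c l" using a c by auto
  then have R: "R > 0" unfolding R_def by simp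
  have gnn: "0 \<le> g k" if k: "k \<in> I + J" for k
  proof -
    obtain i j where ij: "k = i + j" "i \<in> I" "j \<in> J" using k by (elim set_plus_elim)
    have "0 \<le> sqrt (a i * c j)" using a(1)[OF ij(2)] c(1)[OF ij(3)] by simp
    also have "\<dots> \<le> g k" using g ij by simp
    finally show ?thesis .
  qed
  have unit: "0 \<le> a i / a m \<and> a i / a m \<le> 1" if "i \<in> I" for i
    using a(1)[OF that] pos by simp
  have unit': "0 \<le> c j / c l \<and> c j / c l \<le> 1" if "j \<in> J" for j
    using c(1)[OF that] pos by simp
  have "sum (\<lambda>i. a i / a m) I + sum (\<lambda>j. c j / c l) J - 1 \<le> sum (\<lambda>k. g k / R) (I + J)"
  proof (rule sum_sumset_ge[OF fin a(2) _ _ c(2)])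
    fix i j assume ij: "i \<in> I" "j \<in> J"
    define u v where "u = a i / a m" and "v = c j / c l"
    have uv: "0 < u" "0 < v" unfolding u_def v_def using a(1)[OF ij(1)] c(1)[OF ij(2)] pos by auto
    have "min u v \<le> sqrt (u * v)"
    proof (rule real_le_rsqrt)
      show "(min u v)\<^sup>2 \<le> u * v" unfolding power2_eq_square using uv by (intro mult_mono) auto
    qed
    also have "\<dots> = sqrt (a i * c j) / R" unfolding R_def u_def v_def by (simp add: real_sqrt_mult real_sqrt_divide)
    also have "\<dots> \<le> g (i + j) / R" using g[OF ij] R by (simp add: divide_right_mono)
    finally show "min (a i / a m) (c j / c l) \<le> g (i + j) / R" unfolding u_def v_def .
  qed (use unit unit' pos in auto)
  then have "R * (sum a I / a m + sum c J / c l - 1) \<le> R * (sum g (I + J) / R)"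
    using R by (intro mult_left_mono) (auto simp: sum_divide_distrib)
  then show "sqrt (a m * c l) * (sum a I / a m + sum c J / c l - 1) \<le> sum g (I + J)"
    using R pos by (simp add: R_def)
  have sub: "sqrt (sum h K) \<le> sum (\<lambda>i. sqrt (h i)) K" if "finite K" "\<And>i. i \<in> K \<Longrightarrow> 0 \<le> h i"
    for h :: "nat \<Rightarrow> real" and K
    using that
  proof (induction K rule: finite_induct)
    case (insert x F)
    have "sqrt (h x + sum h F) \<le> sqrt (h x) + sqrt (sum h F)"
      using insert by (intro sqrt_add_le_add_sqrt) (auto intro: sum_nonneg)
    then show ?case using insert by fastforce
  qed simp
  have finIJ: "finite (I + J)" using fin by (rule finite_set_plus)
  have "sqrt (c l) * (sqrt (a m) + sqrt (sum a (I - {m}))) \<le> sqrt (c l) * (\<Sum>i\<in>I. sqrt (a i))"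
    using sub[of "I - {m}" a] a fin pos by (intro mult_left_mono) (auto simp: sum.remove[of I m] less_imp_le)
  also have "\<dots> = (\<Sum>i\<in>I. sqrt (a i * c l))" by (simp add: sum_distrib_left real_sqrt_mult mult.commute)
  also have "\<dots> \<le> (\<Sum>i\<in>I. g (i + l))" using g c by (intro sum_mono) auto
  also have "\<dots> = sum g ((\<lambda>i. i + l) ` I)" by (subst sum.reindex) (auto intro: inj_onI)
  also have "\<dots> \<le> sum g (I + J)" using finIJ gnn c by (intro sum_mono2) (auto intro: set_plus_intro)
  finally show "sqrt (c l) * (sqrt (a m) + sqrt (sum a (I - {m}))) \<le> sum g (I + J)" .
  have "sqrt (a m) * (sqrt (c l) + sqrt (sum c (J - {l}))) \<le> sqrt (a m) * (\<Sum>j\<in>J. sqrt (c j))"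
    using sub[of "J - {l}" c] c fin pos by (intro mult_left_mono) (auto simp: sum.remove[of J l] less_imp_le)
  also have "\<dots> = (\<Sum>j\<in>J. sqrt (a m * c j))" by (simp add: sum_distrib_left real_sqrt_mult)
  also have "\<dots> \<le> (\<Sum>j\<in>J. g (m + j))" using g a by (intro sum_mono) auto
  also have "\<dots> = sum g ((\<lambda>j. m + j) ` J)" by (subst sum.reindex) (auto intro: inj_onI)
  also have "\<dots> \<le> sum g (I + J)" using finIJ gnn a by (intro sum_mono2) (auto intro: set_plus_intro)
  finally show "sqrt (a m) * (sqrt (c l) + sqrt (sum c (J - {l}))) \<le> sum g (I + J)" .
qed

section \<open>Recombining the weights of the fibers\<close>

lemma Bernoulli_powr:
  fixes t s :: real
  assumes "0 \<le> t" "0 \<le> s"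
  shows "1 + (1 + s) * (t - 1) \<le> t powr (1 + s)"
proof (cases "t = 0")
  case False
  then have t: "t > 0" using assms by simp
  have "ln (1 / t) \<le> 1 / t - 1" using t by (intro ln_le_minus_one) simp
  then have "1 - 1 / t \<le> ln t" using t by (simp add: ln_div)
  then have "s * (1 - 1 / t) \<le> s * ln t" using assms by (intro mult_left_mono)
  also have "\<dots> \<le> t powr s - 1" using t exp_ge_add_one_self[of "s * ln t"] by (simp add: powr_def algebra_simps)
  finally have "t * (s * (1 - 1 / t)) \<le> t * (t powr s - 1)" using t by (intro mult_left_mono) auto
  then show ?thesis using t by (simp add: powr_add algebra_simps)
qed (use assms in simp)

text \<open>
  Convexity of the perspective function of \<open>t powr (1 + s)\<close>: each summand is bounded below by the
  tangent at the common ratio \<open>R\<close>, and the tangents add up to the left-hand side.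
\<close>
lemma powr_sum_perspective:
  fixes u f :: "'i \<Rightarrow> real" and s :: real
  assumes "\<And>i. i \<in> I \<Longrightarrow> 0 < u i" "\<And>i. i \<in> I \<Longrightarrow> 0 < f i" "0 \<le> s"
  shows "sum u I powr (1 + s) * sum f I powr - s \<le> (\<Sum>i\<in>I. u i powr (1 + s) * f i powr - s)"
proof (cases "I = {} \<or> infinite I")
  case False
  define U F R where "U = sum u I" and "F = sum f I" and "R = U / F"
  have pos: "U > 0" "F > 0" unfolding U_def F_def using False assms by (auto intro!: sum_pos)
  then have R: "R > 0" unfolding R_def by simp
  have scale: "a powr (1 + s) * b powr - s = b * (a / b) powr (1 + s)" if "a > 0" "b > 0" for a b :: real
    using that by (simp add: powr_divide powr_add powr_minus field_simps)
  have "R powr (1 + s) * (f i + (1 + s) * (u i / R - f i)) \<le> u i powr (1 + s) * f i powr - s"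
    if i: "i \<in> I" for i
  proof -
    have f: "f i > 0" "u i > 0" using assms i by auto
    have "R powr (1 + s) * (f i + (1 + s) * (u i / R - f i))
        = R powr (1 + s) * f i * (1 + (1 + s) * (u i / f i / R - 1))"
      using f R by (simp add: field_simps)
    also have "\<dots> \<le> R powr (1 + s) * f i * (u i / f i / R) powr (1 + s)"
      using f R assms(3) by (intro mult_left_mono Bernoulli_powr) auto
    also have "\<dots> = f i * (u i / f i) powr (1 + s)" using R f by (simp add: powr_divide powr_mult)
    finally show ?thesis using scale f by simp
  qed
  then have "(\<Sum>i\<in>I. R powr (1 + s) * (f i + (1 + s) * (u i / R - f i))) \<le> (\<Sum>i\<in>I. u i powr (1 + s) * f i powr - s)"
    by (rule sum_mono)
  moreover have "(\<Sum>i\<in>I. R powr (1 + s) * (f i + (1 + s) * (u i / R - f i))) = R powr (1 + s) * (F + (1 + s) * (U / R - F))"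
    unfolding U_def F_def by (simp add: sum.distrib sum_subtractf sum_divide_distrib flip: sum_distrib_left)
  moreover have "U / R = F" unfolding R_def using pos by simp
  ultimately show ?thesis using scale[OF pos] unfolding U_def[symmetric] F_def[symmetric] R_def by (simp add: mult.commute)
qed auto

text \<open>
  The numerical heart of the induction. Here \<open>W\<close> and \<open>V\<close> are the weights of the two sets, \<open>x\<close> and
  \<open>y\<close> those of their heaviest fibers, which contain the proportions \<open>1 - d\<close> and \<open>1 - e\<close> of the elements,
  and \<open>X\<close> and \<open>Y\<close> the total weights of the other fibers. Think of \<open>s = 0\<close>. For \<open>d \<le> 1/4\<close> the single row
  suffices, because \<open>(1 - d) + sqrt (d * (1 - d)) \<ge> 1\<close> for \<open>d \<le> 1/2\<close>. For \<open>d \<ge> 1/4\<close> the bound for the full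
  sumset gives at least \<open>sqrt ((x + 2 * X) * (y + 2 * Y))\<close>, which wins the factor \<open>1 + d \<ge> 5/4\<close> under the
  root. There is room in both cases, so that the losses \<open>n powr - s\<close> and the exponent \<open>1 + s\<close> are
  harmless for small \<open>s\<close>.
\<close>
lemma fiber_gain_ordered:
  fixes s n x y X Y W V d e S :: real
  assumes s: "0 < s" "s \<le> 1/10" and n: "1 \<le> n" "(4 * n) powr s \<le> 11/10"
    and de: "0 \<le> e" "e \<le> d" "d < 1" and WV: "0 < W" "0 < V" and xy: "0 < x" "0 < y"
    and x: "(1 - d) powr (1 + s) * W \<le> x" and X: "d powr (1 + s) * n powr - s * W \<le> X"
    and y: "(1 - e) powr (1 + s) * V \<le> y" and Y: "e powr (1 + s) * n powr - s * V \<le> Y"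
    and S1: "sqrt (x * y) * (1 + X / x + Y / y) \<le> S"
    and S2: "sqrt y * (sqrt x + sqrt X) \<le> S"
  shows "sqrt (W * V) \<le> S"
proof (cases "d \<le> 1/4")
  case True
  define D where "D = (1 - d) powr (1 + s)"
  define T where "T = d powr (1 + s) * n powr - s"
  have D0: "0 < D" "0 \<le> T" unfolding D_def T_def using de by auto
  have "D \<le> (1 - e) powr (1 + s)" unfolding D_def using de s by (intro powr_mono2) auto
  then have y': "D * V \<le> y" using y WV by (meson mult_right_mono less_imp_le order_trans)
  have "(11/10 * d)\<^sup>2 \<le> D * T"
  proof (cases "d = 0")
    case False
    then have d: "d > 0" using de by simp
    have "16 * n \<le> (4 * n) * (4 * n)" using n by (simp add: mult_le_cancel_left)
    then have "(16 * n) powr s \<le> ((4 * n) * (4 * n)) powr s" using n s by (intro powr_mono2) auto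
    also have "\<dots> = (4 * n) powr s * (4 * n) powr s" by (rule powr_mult)
    also have "\<dots> \<le> 11/10 * (11/10)" using n by (intro mult_mono) auto
    finally have n16: "(16 * n) powr s \<le> 121/100" by simp
    have "4 * d = (4 * d) powr 1" using d by simp
    also have "\<dots> \<le> (4 * d) powr s" using d True s by (intro powr_mono') auto
    finally have ds: "4 * d \<le> (4 * d) powr s" .
    have a: "(1/4) powr s \<le> (1 - d) powr s" using True s by (intro powr_mono2) auto
    have "(16 * n) powr s * ((1 - d) powr s * d powr s * n powr - s)
       = 4 powr s * (1 - d) powr s * (4 * d) powr s"
    proof -
      have "(4 * 4 :: real) powr s = 4 powr s * 4 powr s" by (rule powr_mult)
      moreover have "(4 * 4 :: real) = 16" by simp
      ultimately have "(16::real) powr s = 4 powr s * 4 powr s" by (simp only:)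
      then show ?thesis using n d True by (simp add: powr_mult powr_minus field_simps)
    qed
    also have "\<dots> \<ge> 4 powr s * (1/4) powr s * (4 * d)"
      using a ds d by (intro mult_mono mult_left_mono) auto
    also have "4 powr s * (1/4) powr s * (4 * d) = 4 * d" by (simp flip: powr_mult)
    finally have b: "4 * d \<le> (16 * n) powr s * ((1 - d) powr s * d powr s * n powr - s)" .
    have "(16 * n) powr s * ((1 - d) powr s * d powr s * n powr - s) \<le> 121/100 * ((1 - d) powr s * d powr s * n powr - s)"
      using n16 by (intro mult_right_mono) auto
    then have c: "400/121 * d \<le> (1 - d) powr s * d powr s * n powr - s" using b by simp
    have "D * T = (1 - d) * d * ((1 - d) powr s * d powr s * n powr - s)"
      unfolding D_def T_def using d True by (simp add: powr_add)
    also have "\<dots> \<ge> (3/4 * d) * (400/121 * d)" using c d True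
      by - (rule mult_mono, auto intro: mult_right_mono)
    also have "(3/4 * d) * (400/121 * d) = 300/121 * d\<^sup>2" by (simp add: power2_eq_square)
    finally have "300/121 * d\<^sup>2 \<le> D * T" .
    moreover have "0 \<le> d\<^sup>2" by simp
    ultimately have "121/100 * d\<^sup>2 \<le> D * T" by linarith
    then show ?thesis by (simp add: power_mult_distrib power2_eq_square)
  qed (use D0 in simp)
  then have "11/10 * d \<le> sqrt (D * T)" using real_le_rsqrt by blast
  moreover have "1 - 11/10 * d \<le> D"
  proof -
    have "1 + (1 + s) * ((1 - d) - 1) \<le> D" unfolding D_def using de s by (intro Bernoulli_powr) auto
    moreover have "(1 + s) * d \<le> 11/10 * d" using s de by (intro mult_right_mono) auto
    ultimately show ?thesis by (simp add: algebra_simps)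
  qed
  ultimately have one: "1 \<le> D + sqrt (D * T)" by simp
  have "sqrt (W * V) \<le> sqrt (W * V) * (D + sqrt (D * T))" using mult_left_mono[OF one, of "sqrt (W * V)"] WV by simp
  also have "\<dots> = sqrt (D * V) * (sqrt (D * W) + sqrt (T * W))"
    using D0 by (simp add: real_sqrt_mult algebra_simps)
  also have "\<dots> \<le> sqrt y * (sqrt x + sqrt X)"
    using y' x X WV D0 xy unfolding D_def T_def by (intro mult_mono add_mono) auto
  finally show ?thesis using S2 by simp
next
  case False
  define z where "z = (\<lambda>t. (1 - t) powr (1 + s) + 2 * (t powr (1 + s) * n powr - s))"
  have ns: "n powr - s \<le> 1" using n s powr_mono2'[of "- s" 1 n] by auto
  \<comment> \<open>the tangents of \<open>t powr (1 + s)\<close> at \<open>t = 1/2\<close>\<close>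
  have half: "2 powr - s \<le> (1 - t) powr (1 + s) + t powr (1 + s)" if t: "0 \<le> t" "t \<le> 1" for t
  proof -
    have "2 powr - (1 + s) * (1 + (1 + s) * (2 * r - 1)) \<le> r powr (1 + s)" if "0 \<le> r" for r :: real
    proof -
      have "2 powr - (1 + s) * (1 + (1 + s) * (2 * r - 1)) \<le> 2 powr - (1 + s) * (2 * r) powr (1 + s)"
        using that s by (intro mult_left_mono Bernoulli_powr) auto
      also have "\<dots> = r powr (1 + s)" by (simp add: powr_mult flip: powr_add)
      finally show ?thesis .
    qed
    from add_mono[OF this[of "1 - t"] this[of t]] t
    have "2 powr - (1 + s) * 2 \<le> (1 - t) powr (1 + s) + t powr (1 + s)" by (simp add: algebra_simps)
    moreover have "2 powr - (1 + s) * 2 = (2::real) powr - s"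
      using powr_add[of "2::real" "- (1 + s)" 1] by (simp del: powr_add)
    ultimately show ?thesis by simp
  qed
  have zge: "n powr - s * (2 powr - s + t powr (1 + s)) \<le> z t" if t: "0 \<le> t" "t \<le> 1" for t
  proof -
    have "n powr - s * (2 powr - s + t powr (1 + s)) \<le> n powr - s * ((1 - t) powr (1 + s) + 2 * t powr (1 + s))"
      using half[OF t] by (intro mult_left_mono) auto
    also have "\<dots> = n powr - s * (1 - t) powr (1 + s) + 2 * (t powr (1 + s) * n powr - s)" by (simp add: algebra_simps)
    also have "\<dots> \<le> z t" unfolding z_def
      using mult_right_mono[OF ns, of "(1 - t) powr (1 + s)"] by simp
    finally show ?thesis .
  qed
  define m where "m = (4 * n) powr - s"
  have m: "10/11 \<le> m" unfolding m_def using n by (simp add: powr_minus field_simps)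
  have m4: "m = n powr - s * 4 powr - s" unfolding m_def using n by (simp add: powr_mult)
  have two4: "4 powr - s \<le> (2::real) powr - s" using s powr_mono2'[of "- s" 2 4] by auto
  have "5/4 * m \<le> n powr - s * (2 powr - s + d powr (1 + s))"
  proof -
    have "1/4 * (1/4) powr s \<le> d * d powr s" using False s by (intro mult_mono powr_mono2) auto
    then have "1/4 * 4 powr - s \<le> d powr (1 + s)" using False by (simp add: powr_add powr_minus powr_divide field_simps)
    then have "5/4 * 4 powr - s \<le> 2 powr - s + d powr (1 + s)" using two4 by simp
    then have "n powr - s * (5/4 * 4 powr - s) \<le> n powr - s * (2 powr - s + d powr (1 + s))" by (intro mult_left_mono) auto
    then show ?thesis unfolding m4 by (simp add: algebra_simps)
  qed
  then have zd: "25/22 \<le> z d" using zge[of d] de m by simp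
  have "m \<le> n powr - s * (2 powr - s + e powr (1 + s))"
    unfolding m4 using two4 by (intro mult_left_mono) (auto intro: add_increasing2)
  then have ze: "10/11 \<le> z e" using zge[of e] de m by simp
  have "1 \<le> 25/22 * (10/11 :: real)" by simp
  also have "\<dots> \<le> z d * z e" using zd ze by (intro mult_mono) auto
  finally have zz: "1 \<le> z d * z e" .
  have X0: "0 \<le> X" "0 \<le> Y" using X Y WV by (auto elim!: order_trans[rotated])
  have "sqrt (W * V) \<le> sqrt ((z d * z e) * (W * V))" 
    using mult_right_mono[OF zz, of "W * V"] WV by simp
  also have "\<dots> = sqrt ((z d * W) * (z e * V))" by (simp add: algebra_simps)
  also have "\<dots> \<le> sqrt ((x + 2 * X) * (y + 2 * Y))"
  proof (intro real_sqrt_le_mono mult_mono)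
    show "z d * W \<le> x + 2 * X" "z e * V \<le> y + 2 * Y"
      unfolding z_def using x X y Y by (simp_all add: algebra_simps)
  qed (use WV ze xy X0 in auto)
  also have "\<dots> \<le> sqrt ((x * y) * (1 + X / x + Y / y)\<^sup>2)"
  proof (intro real_sqrt_le_mono)
    define r where "r = X / x" define r' where "r' = Y / y"
    have "(x + 2 * X) * (y + 2 * Y) = (x * y) * ((1 + 2 * r) * (1 + 2 * r'))"
      unfolding r_def r'_def using xy by (simp add: field_simps)
    also have "(1 + 2 * r) * (1 + 2 * r') = (1 + r + r')\<^sup>2 - (r - r')\<^sup>2"
      by (simp add: power2_eq_square algebra_simps)
    also have "\<dots> \<le> (1 + r + r')\<^sup>2" by simp
    finally show "(x + 2 * X) * (y + 2 * Y) \<le> (x * y) * (1 + X / x + Y / y)\<^sup>2"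
      using xy unfolding r_def r'_def by (simp add: mult_left_mono)
  qed
  also have "\<dots> = sqrt (x * y) * (1 + X / x + Y / y)" using xy X0 by (simp add: real_sqrt_mult)
  finally show ?thesis using S1 by simp
qed

lemma fiber_gain:
  fixes s n x y X Y W V d e S :: real
  assumes s: "0 < s" "s \<le> 1/10" and n: "1 \<le> n" "(4 * n) powr s \<le> 11/10"
    and de: "0 \<le> e" "e < 1" "0 \<le> d" "d < 1" and WV: "0 < W" "0 < V" and xy: "0 < x" "0 < y"
    and x: "(1 - d) powr (1 + s) * W \<le> x" and X: "d powr (1 + s) * n powr - s * W \<le> X"
    and y: "(1 - e) powr (1 + s) * V \<le> y" and Y: "e powr (1 + s) * n powr - s * V \<le> Y"
    and S1: "sqrt (x * y) * (1 + X / x + Y / y) \<le> S"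
    and S2: "sqrt y * (sqrt x + sqrt X) \<le> S"
    and S3: "sqrt x * (sqrt y + sqrt Y) \<le> S"
  shows "sqrt (W * V) \<le> S"
proof (cases "e \<le> d")
  case True
  show ?thesis by (rule fiber_gain_ordered[where x=x and y=y and X=X and Y=Y and d=d and e=e]) (use assms True in auto)
next
  case False
  have "sqrt (V * W) \<le> S"
    by (rule fiber_gain_ordered[where x=y and y=x and X=Y and Y=X and d=e and e=d])
      (use assms False in \<open>auto simp: algebra_simps\<close>)
  then show ?thesis by (simp add: mult.commute)
qed

section \<open>Product sets and p-adic fibers\<close>

definition fiber :: "nat \<Rightarrow> nat set \<Rightarrow> nat \<Rightarrow> nat set" where
  "fiber p A i = {a \<in> A. multiplicity p a = i}"

lemma fiber_subset: "fiber p A i \<subseteq> A" by (auto simp: fiber_def)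

lemma finite_fiber: "finite A \<Longrightarrow> finite (fiber p A i)" by (simp add: fiber_def)

lemma card_fibers:
  assumes "finite A"
  shows "card A = (\<Sum>i\<in>multiplicity p ` A. card (fiber p A i))"
  unfolding fiber_def card_eq_sum by (rule sum.image_gen[OF assms])

definition weight :: "(nat set \<Rightarrow> real) \<Rightarrow> real \<Rightarrow> nat set \<Rightarrow> real" where
  "weight f s A = card A powr (1 + s) * f A powr - s"

text \<open>
  The properties of a size function \<open>f\<close> which make \<open>card (A * B) \<ge> sqrt (w A * w B)\<close> hold: the fibers
  over a prime never have larger size than the set, and neither has their total, up to the constant \<open>n\<close>.
\<close>
locale fiber_size =
  fixes f :: "nat set \<Rightarrow> real" and n s :: real
  assumes f_singleton: "a > 0 \<Longrightarrow> 1 \<le> f {a}"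
    and f_pos: "\<lbrakk>finite A; A \<noteq> {}; 0 \<notin> A\<rbrakk> \<Longrightarrow> 0 < f A"
    and f_fiber: "\<lbrakk>prime p; finite A; 0 \<notin> A; i \<in> multiplicity p ` A\<rbrakk> \<Longrightarrow> f (fiber p A i) \<le> f A"
    and f_fibers: "\<lbrakk>prime p; finite A; 0 \<notin> A\<rbrakk> \<Longrightarrow> (\<Sum>i\<in>multiplicity p ` A. f (fiber p A i)) \<le> n * f A"
    and s: "0 < s" "s \<le> 1/10" and n: "1 \<le> n" "(4 * n) powr s \<le> 11/10"
begin

abbreviation w :: "nat set \<Rightarrow> real" where "w \<equiv> weight f s"

lemma w_pos: "\<lbrakk>finite A; A \<noteq> {}; 0 \<notin> A\<rbrakk> \<Longrightarrow> 0 < w A"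
  using f_pos[of A] by (simp add: weight_def card_gt_0_iff)

lemma fiber_ok:
  assumes "finite A" "0 \<notin> A" "i \<in> multiplicity p ` A"
  shows "finite (fiber p A i)" "fiber p A i \<noteq> {}" "0 \<notin> fiber p A i"
  using assms by (auto simp: fiber_def)

text \<open>
  The fiber \<open>m\<close> has the proportion \<open>1 - d\<close> of the elements and inherits \<open>f (fiber p A m) \<le> f A\<close>; the
  remaining fibers share the bound \<open>n * f A\<close> on the sum of their sizes.
\<close>
lemma weight_split:
  assumes p: "prime p" and A: "finite A" "0 \<notin> A" and m: "m \<in> multiplicity p ` A"
  defines "I \<equiv> multiplicity p ` A"
  obtains d where "0 \<le> d" "d < 1" "(1 - d) powr (1 + s) * w A \<le> w (fiber p A m)"
    "d powr (1 + s) * n powr - s * w A \<le> (\<Sum>i\<in>I - {m}. w (fiber p A i))"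
proof -
  define c where "c = real (card A)"
  define u where "u = (\<lambda>i. real (card (fiber p A i)))"
  define d where "d = 1 - u m / c"
  have ne: "A \<noteq> {}" using m by auto
  have finI: "finite I" unfolding I_def using A by simp
  have fA: "f A > 0" using f_pos A ne by simp
  have c: "c > 0" unfolding c_def using A ne by (simp add: card_gt_0_iff)
  have u: "u i > 0" "f (fiber p A i) > 0" if "i \<in> I" for i
    using fiber_ok[OF A, of i p] that f_pos unfolding u_def I_def by (auto simp: card_gt_0_iff)
  have mI: "m \<in> I" using m I_def by simp
  have "c = sum u I" unfolding c_def u_def I_def by (subst card_fibers[OF A(1), of p]) simp
  then have csplit: "c = u m + sum u (I - {m})" using finI mI by (simp add: sum.remove)
  have d0: "0 \<le> d"
    using csplit c sum_nonneg[of "I - {m}" u] u unfolding d_def by (simp add: less_imp_le)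
  have dsum: "sum u (I - {m}) = d * c" proof -
    have "d * c = c - u m" unfolding d_def using c by (simp add: algebra_simps)
    then show ?thesis using csplit by simp
  qed
  have d1: "d < 1" unfolding d_def using u[OF mI] c by simp
  have "(1 - d) powr (1 + s) * w A = (u m / c * c) powr (1 + s) * f A powr - s"
    unfolding weight_def d_def c_def powr_mult by simp
  also have "\<dots> = u m powr (1 + s) * f A powr - s" using c by simp
  also have "\<dots> \<le> w (fiber p A m)"
    unfolding weight_def u_def using u[OF mI] s f_fiber[OF p A m]
    by (intro mult_left_mono powr_mono2') auto
  finally have 1: "(1 - d) powr (1 + s) * w A \<le> w (fiber p A m)" .
  have 2: "d powr (1 + s) * n powr - s * w A \<le> (\<Sum>i\<in>I - {m}. w (fiber p A i))"
  proof (cases "I - {m} = {}")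
    case True
    have "d * c = 0" unfolding dsum[symmetric] True by simp
    then have "d = 0" using c by simp
    then show ?thesis unfolding True by simp
  next
    case False
    let ?F = "\<Sum>i\<in>I - {m}. f (fiber p A i)"
    have F0: "0 < ?F" using False finI u by (intro sum_pos) auto
    have "?F \<le> (\<Sum>i\<in>I. f (fiber p A i))" using finI u by (intro sum_mono2) (auto simp: less_imp_le)
    then have Fn: "?F \<le> n * f A" using f_fibers[OF p A] unfolding I_def by simp
    have "d powr (1 + s) * n powr - s * w A = (d * c) powr (1 + s) * (n * f A) powr - s"
      unfolding weight_def c_def powr_mult by simp
    also have "\<dots> \<le> (d * c) powr (1 + s) * ?F powr - s"
      using F0 Fn s by (intro mult_left_mono powr_mono2') auto
    also have "\<dots> \<le> (\<Sum>i\<in>I - {m}. u i powr (1 + s) * f (fiber p A i) powr - s)"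
      unfolding dsum[symmetric] using u s by (intro powr_sum_perspective) auto
    finally show ?thesis unfolding weight_def u_def .
  qed
  show ?thesis by (rule that[OF d0 d1 1 2])
qed

lemma card_product_fibers:
  assumes p: "prime p" and A: "finite A" "0 \<notin> A" and B: "finite B" "0 \<notin> B"
  shows "multiplicity p ` (A * B) = multiplicity p ` A + multiplicity p ` B"
    and "fiber p A i * fiber p B j \<subseteq> fiber p (A * B) (i + j)"
proof -
  have mult: "multiplicity p (a * b) = multiplicity p a + multiplicity p b" if "a \<in> A" "b \<in> B" for a b
    using p A B that by (intro prime_elem_multiplicity_mult_distrib) (auto intro: ccontr)
  show "multiplicity p ` (A * B) = multiplicity p ` A + multiplicity p ` B"
  proof (intro equalityI subsetI)
    fix k assume "k \<in> multiplicity p ` (A * B)"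
    then show "k \<in> multiplicity p ` A + multiplicity p ` B"
      by (auto elim!: set_times_elim simp: mult intro!: set_plus_intro)
  next
    fix k assume "k \<in> multiplicity p ` A + multiplicity p ` B"
    then obtain a b where ab: "a \<in> A" "b \<in> B" "k = multiplicity p a + multiplicity p b"
      by (auto elim!: set_plus_elim)
    show "k \<in> multiplicity p ` (A * B)"
      using ab mult by (intro image_eqI[of _ _ "a * b"] set_times_intro) auto
  qed
  show "fiber p A i * fiber p B j \<subseteq> fiber p (A * B) (i + j)"
    by (auto simp: fiber_def mult elim!: set_times_elim)
qed

text \<open>
  Induction over a set of primes outside of which all elements of \<open>A\<close>, and all elements of \<open>B\<close>, have
  the same valuations. Without such primes both sets are singletons.
\<close>
theorem card_product_ge_weight:
  assumes "finite P" "finite A" "A \<noteq> {}" "0 \<notin> A" "finite B" "B \<noteq> {}" "0 \<notin> B"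
    and "\<And>p x y. \<lbrakk>prime p; p \<notin> P; x \<in> A; y \<in> A\<rbrakk> \<Longrightarrow> multiplicity p x = multiplicity p y"
    and "\<And>p x y. \<lbrakk>prime p; p \<notin> P; x \<in> B; y \<in> B\<rbrakk> \<Longrightarrow> multiplicity p x = multiplicity p y"
  shows "sqrt (w A * w B) \<le> card (A * B)"
  using assms
proof (induction P arbitrary: A B rule: finite_induct)
  case empty
  have single: "\<exists>a>0. X = {a}" if X: "X \<noteq> {}" "0 \<notin> X"
    and eq: "\<And>p x y. \<lbrakk>prime p; x \<in> X; y \<in> X\<rbrakk> \<Longrightarrow> multiplicity p x = multiplicity p y" for X :: "nat set"
  proof -
    obtain a where a: "a \<in> X" using X by auto
    have a0: "a > 0" using a X(2) by (metis gr0I)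
    have "x = a" if x: "x \<in> X" for x
    proof (rule multiplicity_eq_nat)
      show "x > 0" using x X(2) by (metis gr0I)
      show "a > 0" by (rule a0)
      show "multiplicity p x = multiplicity p a" if "prime p" for p by (rule eq[OF that x a])
    qed
    then have "X = {a}" using a by blast
    then show ?thesis using a0 by blast
  qed
  have "\<exists>a>0. A = {a}"
  proof (rule single[OF empty.prems(2,3)])
    show "multiplicity p x = multiplicity p y" if "prime p" "x \<in> A" "y \<in> A" for p x y
      by (rule empty.prems(7)[OF that(1) _ that(2,3)]) simp
  qed
  then obtain a where a: "a > 0" "A = {a}" by blast
  have "\<exists>b>0. B = {b}"
  proof (rule single[OF empty.prems(5,6)])
    show "multiplicity p x = multiplicity p y" if "prime p" "x \<in> B" "y \<in> B" for p x y
      by (rule empty.prems(8)[OF that(1) _ that(2,3)]) simp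
  qed
  then obtain b where b: "b > 0" "B = {b}" by blast
  have "w {x} \<le> 1" if "x > 0" for x
  proof -
    have "f {x} powr - s \<le> 1 powr - s" using f_singleton[OF that] s by (intro powr_mono2') auto
    then show ?thesis by (simp add: weight_def)
  qed
  then have "w A * w B \<le> 1 * 1" using a b w_pos[of A] w_pos[of B] by (intro mult_mono) (auto simp: less_imp_le)
  then show ?case using a b by (auto simp: set_times_def)
next
  case (insert p P)
  show ?case
  proof (cases "prime p")
    case False
    then show ?thesis using insert.prems by (intro insert.IH) blast+
  next
    case p: True
    define I where "I = multiplicity p ` A"
    define J where "J = multiplicity p ` B"
    define a where "a = (\<lambda>i. w (fiber p A i))"
    define c where "c = (\<lambda>j. w (fiber p B j))"
    define g where "g = (\<lambda>k. real (card (fiber p (A * B) k)))"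
    note A = insert.prems(1,3) note B = insert.prems(4,6)
    have fin: "finite I" "finite J" "I \<noteq> {}" "J \<noteq> {}" unfolding I_def J_def using insert.prems by auto
    have AB: "finite (A * B)" using A B by (intro finite_set_times)
    have apos: "0 < a i" if "i \<in> I" for i
      using that fiber_ok[OF A] unfolding a_def I_def by (intro w_pos) auto
    have cpos: "0 < c j" if "j \<in> J" for j
      using that fiber_ok[OF B] unfolding c_def J_def by (intro w_pos) auto
    have S: "real (card (A * B)) = sum g (I + J)"
      using card_fibers[OF AB, of p] card_product_fibers(1)[OF p A B] unfolding g_def I_def J_def by simp
    have g: "sqrt (a i * c j) \<le> g (i + j)" if "i \<in> I" "j \<in> J" for i j
    proof -
      have "sqrt (a i * c j) \<le> card (fiber p A i * fiber p B j)"
        unfolding a_def c_def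
      proof (rule insert.IH)
        show "finite (fiber p A i)" "fiber p A i \<noteq> {}" "0 \<notin> fiber p A i"
          using fiber_ok[OF A] that unfolding I_def by auto
        show "finite (fiber p B j)" "fiber p B j \<noteq> {}" "0 \<notin> fiber p B j"
          using fiber_ok[OF B] that unfolding J_def by auto
        show "multiplicity q x = multiplicity q y"
          if "prime q" "q \<notin> P" "x \<in> fiber p A i" "y \<in> fiber p A i" for q x y
          using insert.prems(7)[of q x y] that by (cases "q = p") (auto simp: fiber_def)
        show "multiplicity q x = multiplicity q y"
          if "prime q" "q \<notin> P" "x \<in> fiber p B j" "y \<in> fiber p B j" for q x y
          using insert.prems(8)[of q x y] that by (cases "q = p") (auto simp: fiber_def)
      qed
      also have "\<dots> \<le> g (i + j)"
        unfolding g_def using card_product_fibers(2)[OF p A B] AB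
        by (intro of_nat_mono card_mono finite_fiber)
      finally show ?thesis .
    qed
    \<comment> \<open>the fibers of maximal weight, not those with the most elements\<close>
    have "Max (a ` I) \<in> a ` I" "Max (c ` J) \<in> c ` J" using fin by (auto intro!: Max_in)
    then obtain m l where ml: "m \<in> I" "Max (a ` I) = a m" "l \<in> J" "Max (c ` J) = c l" by blast
    have m: "0 < a i \<and> a i \<le> a m" if "i \<in> I" for i
      unfolding ml(2)[symmetric] using fin apos that by auto
    have l: "0 < c j \<and> c j \<le> c l" if "j \<in> J" for j
      unfolding ml(4)[symmetric] using fin cpos that by auto
    note ineqs = sumset_weight_bounds[where a = a and c = c and g = g and I = I and J = J, OF fin(1,2) m ml(1) l ml(3) g]
    obtain d where d: "0 \<le> d" "d < 1" "(1 - d) powr (1 + s) * w A \<le> a m"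
      "d powr (1 + s) * n powr - s * w A \<le> sum a (I - {m})"
      using weight_split[OF p A ml(1)[unfolded I_def]] unfolding a_def I_def by auto
    obtain e where e: "0 \<le> e" "e < 1" "(1 - e) powr (1 + s) * w B \<le> c l"
      "e powr (1 + s) * n powr - s * w B \<le> sum c (J - {l})"
      using weight_split[OF p B ml(3)[unfolded J_def]] unfolding c_def J_def by auto
    have pos: "0 < a m" "0 < c l" using m l ml by auto
    have eq: "sum a I / a m + sum c J / c l - 1 = 1 + sum a (I - {m}) / a m + sum c (J - {l}) / c l"
      using sum.remove[OF fin(1) ml(1), of a] sum.remove[OF fin(2) ml(3), of c] pos
      by (simp add: add_divide_distrib)
    have "0 < w A" "0 < w B" using w_pos insert.prems(1-6) by auto
    then show ?thesis
      unfolding S by (rule fiber_gain[OF s n e(1,2) d(1,2) _ _ pos d(3,4) e(3,4)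
            ineqs(1)[unfolded eq] ineqs(2,3)])
  qed
qed

end

section \<open>Additive energy and p-adic fibers\<close>

definition root_char :: "nat \<Rightarrow> int \<Rightarrow> complex" where
  "root_char M t = cis (2 * pi * of_int t / of_nat M)"

lemma root_char_add: "root_char M (s + t) = root_char M s * root_char M t"
  by (simp add: root_char_def cis_mult algebra_simps add_divide_distrib)

lemma root_char_0 [simp]: "root_char M 0 = 1"
  by (simp add: root_char_def)

lemma root_char_minus: "root_char M (- t) = cnj (root_char M t)"
  by (simp add: root_char_def cis_cnj)

lemma root_char_sum: "root_char M (sum g I) = (\<Prod>i\<in>I. root_char M (g i))"
  by (induction I rule: infinite_finite_induct) (simp_all add: root_char_add)

lemma root_char_power: "root_char M (t * int x) = root_char M t ^ x"
  by (induction x) (simp_all add: root_char_add algebra_simps)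

lemma root_char_eq_1_iff:
  assumes "M > 0"
  shows "root_char M t = 1 \<longleftrightarrow> int M dvd t"
proof
  assume "int M dvd t"
  then obtain q where q: "t = int M * q" by blast
  have "2 * pi * of_int t / of_nat M = 2 * pi * of_int q"
    unfolding q using assms by simp
  then show "root_char M t = 1"
    unfolding root_char_def by (simp only: cis_multiple_2pi Ints_of_int)
next
  assume "root_char M t = 1"
  then have "cos (2 * pi * of_int t / of_nat M) = 1"
    by (simp add: root_char_def complex_eq_iff)
  then obtain q :: int where "2 * pi * of_int t / of_nat M = of_int q * 2 * pi"
    using cos_one_2pi_int by blast
  then have "real_of_int t = real_of_int (q * int M)" using assms by (simp add: field_simps)
  then have "t = q * int M" by (simp only: of_int_eq_iff)
  then show "int M dvd t" by simp
qed

lemma sum_root_char: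
  assumes "M > 0"
  shows "(\<Sum>x<M. root_char M (t * int x)) = (if int M dvd t then of_nat M else 0)"
proof (cases "int M dvd t")
  case True
  then have "root_char M t = 1" using root_char_eq_1_iff[OF assms] by simp
  then show ?thesis using True by (simp add: root_char_power)
next
  case False
  let ?z = "root_char M t"
  have "?z \<noteq> 1" using False root_char_eq_1_iff[OF assms] by simp
  moreover have "?z ^ M = 1" using root_char_eq_1_iff[OF assms, of "t * int M"] by (simp add: root_char_power)
  ultimately have "(\<Sum>x<M. ?z ^ x) = 0" by (simp add: geometric_sum)
  then show ?thesis using False by (simp add: root_char_power)
qed

definition fourier :: "nat \<Rightarrow> nat set \<Rightarrow> nat \<Rightarrow> complex" where
  "fourier M S x = (\<Sum>a\<in>S. root_char M (int a * int x))"

text \<open>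
  Orthogonality of the characters modulo \<open>M\<close> counts solutions of a congruence; when \<open>M\<close> exceeds all
  values of the linear form, a congruence modulo \<open>M\<close> is an equation.
\<close>
lemma count_solutions:
  fixes \<sigma> :: "nat \<Rightarrow> int" and B :: "nat \<Rightarrow> nat set"
  assumes "M > 0" "finite I" "\<And>i. i \<in> I \<Longrightarrow> finite (B i)"
    and \<sigma>: "\<And>i. i \<in> I \<Longrightarrow> \<sigma> i = 1 \<or> \<sigma> i = - 1"
    and small: "\<And>h. h \<in> PiE I B \<Longrightarrow> \<bar>\<Sum>i\<in>I. \<sigma> i * int (h i)\<bar> < int M"
  shows "of_nat (M * card {h \<in> PiE I B. (\<Sum>i\<in>I. \<sigma> i * int (h i)) = 0})
    = (\<Sum>x<M. \<Prod>i\<in>I. if \<sigma> i = 1 then fourier M (B i) x else cnj (fourier M (B i) x))"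
proof -
  have fin: "finite (PiE I B)" using assms by (intro finite_PiE) auto
  have "(\<Sum>x<M. \<Prod>i\<in>I. if \<sigma> i = 1 then fourier M (B i) x else cnj (fourier M (B i) x))
      = (\<Sum>x<M. \<Prod>i\<in>I. \<Sum>a\<in>B i. root_char M (\<sigma> i * int a * int x))"
  proof (intro sum.cong prod.cong refl)
    fix x i assume "i \<in> I"
    then show "(if \<sigma> i = 1 then fourier M (B i) x else cnj (fourier M (B i) x))
        = (\<Sum>a\<in>B i. root_char M (\<sigma> i * int a * int x))"
      using \<sigma>[of i] by (auto simp: fourier_def root_char_minus)
  qed
  also have "\<dots> = (\<Sum>x<M. \<Sum>h\<in>PiE I B. \<Prod>i\<in>I. root_char M (\<sigma> i * int (h i) * int x))"
    using assms by (intro sum.cong refl prod_sum_PiE) auto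
  also have "\<dots> = (\<Sum>h\<in>PiE I B. \<Sum>x<M. root_char M ((\<Sum>i\<in>I. \<sigma> i * int (h i)) * int x))"
    by (subst sum.swap) (simp add: root_char_sum sum_distrib_right)
  also have "\<dots> = (\<Sum>h\<in>PiE I B. if (\<Sum>i\<in>I. \<sigma> i * int (h i)) = 0 then of_nat M else 0)"
  proof (intro sum.cong refl)
    fix h assume "h \<in> PiE I B"
    then have "\<bar>\<Sum>i\<in>I. \<sigma> i * int (h i)\<bar> < int M" by (rule small)
    then have "int M dvd (\<Sum>i\<in>I. \<sigma> i * int (h i)) \<longleftrightarrow> (\<Sum>i\<in>I. \<sigma> i * int (h i)) = 0"
      using dvd_imp_le_int[of "\<Sum>i\<in>I. \<sigma> i * int (h i)" "int M"] by auto
    then show "(\<Sum>x<M. root_char M ((\<Sum>i\<in>I. \<sigma> i * int (h i)) * int x))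
        = (if (\<Sum>i\<in>I. \<sigma> i * int (h i)) = 0 then of_nat M else 0)"
      using sum_root_char[OF assms(1)] by simp
  qed
  also have "\<dots> = of_nat (M * card {h \<in> PiE I B. (\<Sum>i\<in>I. \<sigma> i * int (h i)) = 0})"
    using fin by (simp add: sum.If_cases Int_def mult.commute)
  finally show ?thesis ..
qed

definition half_sign :: "nat \<Rightarrow> nat \<Rightarrow> int" where
  "half_sign k i = (if i < k then 1 else - 1)"

text \<open>
  The equation \<open>h 0 + \<dots> + h (k - 1) = h k + \<dots> + h (2 * k - 1)\<close>, with each unknown in a set of its
  own. The energy is the \<open>2 k\<close>-th moment of the Fourier transform of \<open>S\<close>.
\<close>
definition solutions :: "nat \<Rightarrow> (nat \<Rightarrow> nat set) \<Rightarrow> (nat \<Rightarrow> nat) set" where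
  "solutions k B = {h \<in> PiE {..<2 * k} B. (\<Sum>i<2 * k. half_sign k i * int (h i)) = 0}"

definition energy :: "nat \<Rightarrow> nat set \<Rightarrow> nat" where
  "energy k S = card (solutions k (\<lambda>_. S))"

lemma finite_solutions: "(\<And>i. finite (B i)) \<Longrightarrow> finite (solutions k B)"
  unfolding solutions_def using finite_PiE[of "{..<2 * k}" B] by simp

lemma half_sign_sum_small:
  assumes h: "\<And>i. i < 2 * k \<Longrightarrow> h i \<le> N"
  shows "\<bar>\<Sum>i<2 * k. half_sign k i * int (h i)\<bar> < int (2 * k * N + 1)"
proof -
  have "\<bar>\<Sum>i<2 * k. half_sign k i * int (h i)\<bar> \<le> (\<Sum>i<2 * k. \<bar>half_sign k i * int (h i)\<bar>)"
    by (rule sum_abs)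
  also have "\<dots> \<le> (\<Sum>i<2 * k. int N)"
    using h by (intro sum_mono) (auto simp: half_sign_def abs_mult)
  finally show ?thesis by simp
qed

lemma card_solutions_le:
  fixes k N :: nat
  assumes "\<And>i. finite (B i)" "\<And>i a. a \<in> B i \<Longrightarrow> a \<le> N"
  defines "M \<equiv> 2 * k * N + 1"
  shows "real M * card (solutions k B) \<le> (\<Sum>x<M. \<Prod>i<2 * k. norm (fourier M (B i) x))"
proof -
  have small: "\<bar>\<Sum>i<2 * k. half_sign k i * int (h i)\<bar> < int M" if "h \<in> PiE {..<2 * k} B" for h
    unfolding M_def using that assms(2) by (intro half_sign_sum_small) (auto simp: PiE_iff)
  have "real M * card (solutions k B) = norm (of_nat (M * card (solutions k B)) :: complex)"
    by (simp add: norm_mult)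
  also have "\<dots> = norm (\<Sum>x<M. \<Prod>i<2 * k. if half_sign k i = 1 then fourier M (B i) x else cnj (fourier M (B i) x))"
    unfolding solutions_def using assms(1) small
    by (subst count_solutions) (auto simp: M_def half_sign_def)
  also have "\<dots> \<le> (\<Sum>x<M. \<Prod>i<2 * k. norm (fourier M (B i) x))"
    by (rule sum_norm_le) (auto simp flip: prod_norm intro!: prod_mono)
  finally show ?thesis .
qed

lemma energy_eq:
  fixes k N :: nat
  assumes "finite S" "\<And>a. a \<in> S \<Longrightarrow> a \<le> N"
  defines "M \<equiv> 2 * k * N + 1"
  shows "real M * energy k S = (\<Sum>x<M. norm (fourier M S x) ^ (2 * k))"
proof -
  have small: "\<bar>\<Sum>i<2 * k. half_sign k i * int (h i)\<bar> < int M" if "h \<in> PiE {..<2 * k} (\<lambda>_. S)" for h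
    unfolding M_def using that assms(2) by (intro half_sign_sum_small) (auto simp: PiE_iff)
  have prod: "(\<Prod>i<2 * k. if half_sign k i = 1 then z else cnj z) = of_real (norm z ^ (2 * k))" for z
  proof -
    have "(\<Prod>i<2 * k. if half_sign k i = 1 then z else cnj z)
        = (\<Prod>i<k. if half_sign k i = 1 then z else cnj z) * (\<Prod>i=k..<2*k. if half_sign k i = 1 then z else cnj z)"
      unfolding lessThan_atLeast0 by (rule prod.atLeastLessThan_concat[symmetric]) auto
    also have "(\<Prod>i<k. if half_sign k i = 1 then z else cnj z) = (\<Prod>i<k. z)"
      by (rule prod.cong) (auto simp: half_sign_def)
    also have "(\<Prod>i=k..<2*k. if half_sign k i = 1 then z else cnj z) = (\<Prod>i=k..<2*k. cnj z)"
      by (rule prod.cong) (auto simp: half_sign_def)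
    also have "(\<Prod>i<k. z) * (\<Prod>i=k..<2*k. cnj z) = (z * cnj z) ^ k"
      by (simp add: power_mult_distrib)
    also have "\<dots> = of_real (norm z ^ (2 * k))"
      by (simp add: complex_norm_square[symmetric] power_mult)
    finally show ?thesis .
  qed
  have "(of_nat (M * energy k S) :: complex)
      = (\<Sum>x<M. \<Prod>i<2 * k. if half_sign k i = 1 then fourier M S x else cnj (fourier M S x))"
    unfolding energy_def solutions_def using assms(1) small
    by (subst count_solutions) (auto simp: M_def half_sign_def)
  also have "\<dots> = of_real (\<Sum>x<M. norm (fourier M S x) ^ (2 * k))"
    unfolding prod by simp
  finally have "(of_real (real M * energy k S) :: complex) = of_real (\<Sum>x<M. norm (fourier M S x) ^ (2 * k))"
    by simp
  then show ?thesis by (simp only: of_real_eq_iff)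
qed

text \<open>
  The weighted inequality of arithmetic and geometric means. Applied pointwise to normalized quantities
  it replaces Hoelder's inequality in \<open>energy_le_of_fibers\<close>.
\<close>
lemma Young_power:
  fixes u v :: real
  assumes "0 \<le> u" "0 \<le> v"
  shows "real (Suc m) * (u * v ^ m) \<le> u ^ Suc m + real m * v ^ Suc m"
proof (induction m)
  case (Suc m)
  have "0 \<le> real (Suc m) * v ^ m * (u - v)\<^sup>2" using assms by simp
  also have "\<dots> = real (Suc m) * (u * v ^ m) * u + real (Suc m) * v ^ Suc (Suc m) - 2 * real (Suc m) * (u * v ^ Suc m)"
    by (simp add: power2_eq_square algebra_simps)
  also have "real (Suc m) * (u * v ^ m) * u \<le> (u ^ Suc m + real m * v ^ Suc m) * u"
    using Suc assms by (intro mult_right_mono) auto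
  finally show ?case by (simp add: algebra_simps)
qed simp

text \<open>
  If the least valuation \<open>v\<close> occurred only once, then all other terms, and hence this one, would be
  divisible by \<open>p ^ (v + 1)\<close>.
\<close>
lemma solution_repeats_valuation:
  fixes h :: "nat \<Rightarrow> nat" and \<sigma> :: "nat \<Rightarrow> int"
  assumes p: "prime p" and I: "finite I" "I \<noteq> {}" and h: "\<And>i. i \<in> I \<Longrightarrow> 0 < h i"
    and \<sigma>: "\<And>i. i \<in> I \<Longrightarrow> \<sigma> i = 1 \<or> \<sigma> i = - 1"
    and zero: "(\<Sum>i\<in>I. \<sigma> i * int (h i)) = 0"
  obtains l l' where "l \<in> I" "l' \<in> I" "l \<noteq> l'" "multiplicity p (h l) = multiplicity p (h l')"
proof -
  define v where "v = (\<lambda>i. multiplicity p (h i))"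
  have "Min (v ` I) \<in> v ` I" using I by (intro Min_in) auto
  then obtain l where l: "l \<in> I" "Min (v ` I) = v l" by blast
  have "\<exists>l'\<in>I. l' \<noteq> l \<and> v l' = v l"
  proof (rule ccontr)
    assume c: "\<not> ?thesis"
    have dvd: "int (p ^ Suc (v l)) dvd \<sigma> i * int (h i)" if i: "i \<in> I - {l}" for i
    proof -
      have "v l \<le> v i" unfolding l(2)[symmetric] using I i by auto
      moreover have "v i \<noteq> v l" using c i by auto
      ultimately have "Suc (v l) \<le> multiplicity p (h i)" unfolding v_def by simp
      then have "p ^ Suc (v l) dvd h i" by (rule multiplicity_dvd')
      then have "int (p ^ Suc (v l)) dvd int (h i)" by (simp only: of_nat_dvd_iff)
      then show ?thesis by (rule dvd_mult)
    qed
    have "\<sigma> l * int (h l) = - (\<Sum>i\<in>I - {l}. \<sigma> i * int (h i))"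
      using zero sum.remove[OF I(1) l(1), of "\<lambda>i. \<sigma> i * int (h i)"] by simp
    then have "int (p ^ Suc (v l)) dvd \<sigma> l * int (h l)"
      using dvd by (simp only: dvd_minus_iff) (rule dvd_sum)
    then have "int (p ^ Suc (v l)) dvd int (h l)" using \<sigma>[OF l(1)] by auto
    then have "p ^ Suc (v l) dvd h l" by (simp only: of_nat_dvd_iff)
    moreover have "\<not> p ^ Suc (multiplicity p (h l)) dvd h l"
    proof -
      have "h l \<noteq> 0" "\<not> is_unit p" using h[OF l(1)] p by auto
      then show ?thesis by (simp add: power_dvd_iff_le_multiplicity del: power_Suc)
    qed
    ultimately show False unfolding v_def by simp
  qed
  then obtain l' where "l' \<in> I" "l' \<noteq> l" "v l' = v l" by blast
  then show ?thesis using that[of l l'] l(1) unfolding v_def by simp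
qed

text \<open>
  Write \<open>\<phi>\<close> and \<open>\<psi> i\<close> for the absolute values of the Fourier transforms of \<open>S\<close> and of its fibers. Each
  solution has two positions of equal valuation, so that the moment \<open>Q\<close> of \<open>\<phi> ^ (2 * k)\<close> is at most
  \<open>4 k\<^sup>2\<close> times the sum over \<open>i\<close> of the moments of \<open>\<psi> i ^ 2 * \<phi> ^ (2 * k - 2)\<close>. Young's inequality turns
  this into \<open>Q \<le> (T ^ k * M + (k - 1) * Q) / k\<close>, where \<open>T ^ k\<close> is the bound to be proved for
  \<open>Q / M\<close>, and so \<open>Q \<le> T ^ k * M\<close>.
\<close>
lemma energy_le_of_fibers:
  fixes L :: real and k :: nat
  assumes p: "prime p" and S: "finite S" "S \<noteq> {}" "0 \<notin> S" and k: "k > 0" and L: "L > 0"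
    and fib: "\<And>i. i \<in> multiplicity p ` S \<Longrightarrow> energy k (fiber p S i) \<le> (L * card (fiber p S i)) ^ k"
  shows "energy k S \<le> (4 * real k ^ 2 * L * card S) ^ k"
proof -
  define I where "I = multiplicity p ` S"
  define N where "N = Max S"
  define M where "M = 2 * k * N + 1"
  define c where "c = (\<lambda>i. real (card (fiber p S i)))"
  define \<phi> where "\<phi> = (\<lambda>x. norm (fourier M S x))"
  define \<psi> where "\<psi> = (\<lambda>i x. norm (fourier M (fiber p S i) x))"
  define T where "T = 4 * real k ^ 2 * L * card S"
  define Q where "Q = (\<Sum>x<M. \<phi> x ^ (2 * k))"
  define D where "D = {(l, l'). l < 2 * k \<and> l' < 2 * k \<and> l \<noteq> l'}"
  define B where "B = (\<lambda>(l::nat) (l'::nat) i (r::nat). if r = l \<or> r = l' then fiber p S i else S)"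
  obtain m where m: "k = Suc m" using k by (cases k) auto
  have N: "a \<le> N" if "a \<in> S" for a unfolding N_def using S that by simp
  have finI: "finite I" unfolding I_def using S by simp
  have cpos: "0 < c i" if "i \<in> I" for i
    using that S unfolding c_def I_def by (auto simp: card_gt_0_iff finite_fiber) (auto simp: fiber_def)
  have csum: "real (card S) = sum c I" unfolding c_def I_def using card_fibers[OF S(1), of p] by simp
  have T: "T > 0" unfolding T_def using k L S by (simp add: card_gt_0_iff)
  have M: "M > 0" unfolding M_def by simp
  have Q: "real M * energy k S = Q"
    unfolding Q_def M_def \<phi>_def by (rule energy_eq[OF S(1) N])
  have Qi: "(\<Sum>x<M. \<psi> i x ^ (2 * k)) \<le> real M * (L * c i) ^ k" if "i \<in> I" for i
  proof -
    have "(\<Sum>x<M. \<psi> i x ^ (2 * k)) = real M * energy k (fiber p S i)"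
      unfolding \<psi>_def M_def
      by (rule energy_eq[symmetric]) (use S N in \<open>auto simp: finite_fiber fiber_def\<close>)
    also have "\<dots> \<le> real M * (L * c i) ^ k"
      unfolding c_def using fib[of i] that by (intro mult_left_mono) (auto simp: I_def)
    finally show ?thesis .
  qed
  have D: "finite D" "real (card D) \<le> 4 * real k ^ 2"
  proof -
    have sub: "D \<subseteq> {..<2 * k} \<times> {..<2 * k}" unfolding D_def by auto
    then show "finite D" by (rule finite_subset) simp
    have "card D \<le> card ({..<2 * k} \<times> {..<2 * k})" using sub by (intro card_mono) auto
    then have "real (card D) \<le> real (2 * k * (2 * k))" by (simp only: card_cartesian_product card_lessThan of_nat_le_iff)
    then show "real (card D) \<le> 4 * real k ^ 2" by (simp add: power2_eq_square)
  qed
  have finB: "finite (B l l' i r)" "B l l' i r \<subseteq> S" for l l' i r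
    unfolding B_def using S fiber_subset by (auto simp: finite_fiber)
  have "solutions k (\<lambda>_. S) \<subseteq> (\<Union>(l, l')\<in>D. \<Union>i\<in>I. solutions k (B l l' i))"
  proof
    fix h assume h: "h \<in> solutions k (\<lambda>_. S)"
    then have hS: "h \<in> PiE {..<2 * k} (\<lambda>_. S)" and z: "(\<Sum>i<2 * k. half_sign k i * int (h i)) = 0"
      unfolding solutions_def by auto
    have pos: "0 < h i" if "i \<in> {..<2 * k}" for i
      using PiE_mem[OF hS that] S(3) by (metis gr0I)
    have "half_sign k i = 1 \<or> half_sign k i = - 1" for i unfolding half_sign_def by simp
    moreover have "{..<2 * k} \<noteq> {}" using k by (auto simp: lessThan_empty_iff)
    ultimately obtain l l' where l: "l < 2 * k" "l' < 2 * k" "l \<noteq> l'" "multiplicity p (h l) = multiplicity p (h l')"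
      using solution_repeats_valuation[OF p finite_lessThan _ pos _ z] by (metis lessThan_iff)
    define i where "i = multiplicity p (h l)"
    have "h l \<in> S" using PiE_mem[OF hS] l by auto
    then have "i \<in> I" unfolding i_def I_def by auto
    moreover have "h \<in> solutions k (B l l' i)"
      unfolding solutions_def using hS z l by (auto simp: PiE_iff B_def fiber_def i_def)
    moreover have "(l, l') \<in> D" unfolding D_def using l by simp
    ultimately show "h \<in> (\<Union>(l, l')\<in>D. \<Union>i\<in>I. solutions k (B l l' i))" by blast
  qed
  then have "energy k S \<le> card (\<Union>(l, l')\<in>D. \<Union>i\<in>I. solutions k (B l l' i))"
    unfolding energy_def using D finI finB by (intro card_mono) (auto intro!: finite_solutions)
  also have "\<dots> \<le> (\<Sum>(l, l')\<in>D. \<Sum>i\<in>I. card (solutions k (B l l' i)))"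
    using card_UN_le[OF D(1)] card_UN_le[OF finI]
    by (auto intro!: order_trans[OF card_UN_le[OF D(1)]] sum_mono)
  finally have "real M * energy k S \<le> real M * real (\<Sum>(l, l')\<in>D. \<Sum>i\<in>I. card (solutions k (B l l' i)))"
    by (intro mult_left_mono) (simp_all only: of_nat_le_iff of_nat_0_le_iff)
  also have "\<dots> = (\<Sum>(l, l')\<in>D. \<Sum>i\<in>I. real M * card (solutions k (B l l' i)))"
    by (simp add: sum_distrib_left case_prod_unfold)
  also have "\<dots> \<le> (\<Sum>(l, l')\<in>D. \<Sum>i\<in>I. \<Sum>x<M. \<psi> i x ^ 2 * (\<phi> x ^ 2) ^ m)"
  proof (intro sum_mono, clarify, intro sum_mono)
    fix l l' i assume l: "(l, l') \<in> D" and i: "i \<in> I"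
    have "real M * card (solutions k (B l l' i)) \<le> (\<Sum>x<M. \<Prod>r<2 * k. norm (fourier M (B l l' i r) x))"
      unfolding M_def using finB N by (intro card_solutions_le) blast+
    also have "\<dots> = (\<Sum>x<M. \<psi> i x ^ 2 * (\<phi> x ^ 2) ^ m)"
    proof (intro sum.cong refl)
      fix x
      have "(\<Prod>r<2 * k. norm (fourier M (B l l' i r) x))
          = (\<Prod>r\<in>{l, l'} \<union> ({..<2 * k} - {l, l'}). norm (fourier M (B l l' i r) x))"
        using l by (intro prod.cong) (auto simp: D_def)
      also have "\<dots> = (\<Prod>r\<in>{l, l'}. norm (fourier M (B l l' i r) x)) * (\<Prod>r\<in>{..<2 * k} - {l, l'}. norm (fourier M (B l l' i r) x))"
        by (rule prod.union_disjoint) auto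
      also have "(\<Prod>r\<in>{l, l'}. norm (fourier M (B l l' i r) x)) = \<psi> i x ^ 2"
        using l by (simp add: D_def B_def \<psi>_def power2_eq_square)
      also have "(\<Prod>r\<in>{..<2 * k} - {l, l'}. norm (fourier M (B l l' i r) x)) = (\<Prod>r\<in>{..<2 * k} - {l, l'}. \<phi> x)"
        by (rule prod.cong) (auto simp: B_def \<phi>_def)
      also have "\<dots> = (\<phi> x ^ 2) ^ m"
        using l by (simp add: D_def m card_Diff_subset flip: power_mult)
      finally show "(\<Prod>r<2 * k. norm (fourier M (B l l' i r) x)) = \<psi> i x ^ 2 * (\<phi> x ^ 2) ^ m" .
    qed
    finally show "real M * card (solutions k (B l l' i)) \<le> (\<Sum>x<M. \<psi> i x ^ 2 * (\<phi> x ^ 2) ^ m)" .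
  qed
  also have "\<dots> = card D * (\<Sum>i\<in>I. \<Sum>x<M. \<psi> i x ^ 2 * (\<phi> x ^ 2) ^ m)"
    by (simp add: case_prod_unfold)
  also have "\<dots> \<le> 4 * real k ^ 2 * (\<Sum>i\<in>I. \<Sum>x<M. \<psi> i x ^ 2 * (\<phi> x ^ 2) ^ m)"
    using D by (intro mult_right_mono sum_nonneg) auto
  also have "\<dots> \<le> 4 * real k ^ 2 * (\<Sum>i\<in>I. (L * c i) * T ^ m * ((M + m * (Q / T ^ k)) / k))"
  proof (intro mult_left_mono sum_mono)
    fix i assume i: "i \<in> I"
    have Lc: "L * c i > 0" using cpos[OF i] L by simp
    have "(\<Sum>x<M. \<psi> i x ^ 2 * (\<phi> x ^ 2) ^ m)
        = (L * c i) * T ^ m * (\<Sum>x<M. \<psi> i x ^ 2 / (L * c i) * (\<phi> x ^ 2 / T) ^ m)"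
      using Lc T cpos[OF i] L by (simp add: sum_distrib_left power_divide)
    also have "\<dots> \<le> (L * c i) * T ^ m * (\<Sum>x<M. ((\<psi> i x ^ 2 / (L * c i)) ^ k + m * (\<phi> x ^ 2 / T) ^ k) / k)"
    proof (intro mult_left_mono sum_mono)
      fix x
      show "\<psi> i x ^ 2 / (L * c i) * (\<phi> x ^ 2 / T) ^ m \<le> ((\<psi> i x ^ 2 / (L * c i)) ^ k + m * (\<phi> x ^ 2 / T) ^ k) / k"
        using Young_power[of "\<psi> i x ^ 2 / (L * c i)" "\<phi> x ^ 2 / T" m] Lc T
        unfolding m by (simp add: pos_le_divide_eq mult.commute del: power_Suc of_nat_Suc)
    qed (use Lc T in auto)
    also have "(\<Sum>x<M. ((\<psi> i x ^ 2 / (L * c i)) ^ k + m * (\<phi> x ^ 2 / T) ^ k) / k)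
        = ((\<Sum>x<M. \<psi> i x ^ (2 * k)) / (L * c i) ^ k + m * (Q / T ^ k)) / k"
      unfolding Q_def by (simp add: sum.distrib power_divide sum_divide_distrib sum_distrib_left add_divide_distrib flip: power_mult)
    also have "(L * c i) * T ^ m * \<dots> \<le> (L * c i) * T ^ m * ((M + m * (Q / T ^ k)) / k)"
      using Qi[OF i] Lc T
      by (intro mult_left_mono divide_right_mono add_right_mono) (auto simp: pos_divide_le_eq)
    finally show "(\<Sum>x<M. \<psi> i x ^ 2 * (\<phi> x ^ 2) ^ m) \<le> (L * c i) * T ^ m * ((M + m * (Q / T ^ k)) / k)" .
  qed auto
  also have "\<dots> = (4 * real k ^ 2 * L * sum c I) * T ^ m * ((M + m * (Q / T ^ k)) / k)"
    by (simp add: sum_distrib_left sum_distrib_right algebra_simps)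
  also have "\<dots> = T ^ k * ((M + m * (Q / T ^ k)) / k)"
    unfolding csum[symmetric] T_def[symmetric] by (simp add: m)
  finally have "Q \<le> T ^ k * ((M + m * (Q / T ^ k)) / k)" unfolding Q .
  then have "Q * k \<le> T ^ k * (M + m * (Q / T ^ k))" using k by (simp add: field_simps)
  also have "\<dots> = T ^ k * M + m * Q" using T by (simp add: algebra_simps)
  finally have "Q \<le> T ^ k * M" unfolding m by (simp add: algebra_simps)
  then have "real M * energy k S \<le> real M * T ^ k" unfolding Q by (simp add: mult.commute)
  then show ?thesis using M unfolding T_def by simp
qed

section \<open>Large subsets with small energy\<close>

text \<open>
  The trivial solutions alone are at least \<open>card S ^ k\<close> many, so \<open>L\<close> measures how far the energy exceeds
  the least possible one. The bound is imposed on all subsets so that it is inherited by subsets and can be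
  checked on fibers.
\<close>
definition small_energy :: "nat \<Rightarrow> real \<Rightarrow> nat set \<Rightarrow> bool" where
  "small_energy k L A \<longleftrightarrow> (\<forall>S\<subseteq>A. real (energy k S) \<le> (L * real (card S)) ^ k)"

lemma energy_empty: "k > 0 \<Longrightarrow> energy k {} = 0"
proof -
  assume "k > 0"
  then have "PiE {..<2 * k} (\<lambda>_. {}) = ({} :: (nat \<Rightarrow> nat) set)"
    unfolding PiE_eq_empty_iff by (auto intro: exI[of _ 0])
  then show "energy k {} = 0" by (simp add: energy_def solutions_def)
qed

lemma small_energy_subset: "small_energy k L A \<Longrightarrow> S \<subseteq> A \<Longrightarrow> small_energy k L S"
  by (auto simp: small_energy_def)

lemma small_energy_mono:
  assumes "small_energy k L A" "0 \<le> L" "L \<le> L'"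
  shows "small_energy k L' A"
  unfolding small_energy_def
proof (intro allI impI)
  fix S assume "S \<subseteq> A"
  then have "real (energy k S) \<le> (L * real (card S)) ^ k" using assms(1) by (simp add: small_energy_def)
  also have "\<dots> \<le> (L' * card S) ^ k" using assms by (intro power_mono mult_right_mono) auto
  finally show "real (energy k S) \<le> (L' * real (card S)) ^ k" .
qed

lemma small_energy_singleton:
  assumes "k > 0" "1 \<le> L"
  shows "small_energy k L {a}"
  unfolding small_energy_def
proof (intro allI impI)
  fix S :: "nat set" assume "S \<subseteq> {a}"
  then consider "S = {}" | "S = {a}" by blast
  then show "real (energy k S) \<le> (L * real (card S)) ^ k"
  proof cases
    case 1
    then show ?thesis using assms energy_empty by simp
  next
    case 2
    have "energy k S \<le> card (PiE {..<2 * k} (\<lambda>_. {a}))"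
      unfolding energy_def solutions_def 2 by (intro card_mono finite_PiE) auto
    then have "real (energy k S) \<le> 1" by (simp add: card_PiE)
    also have "1 \<le> (L * card S) ^ k" using assms 2 by (simp add: one_le_power)
    finally show ?thesis .
  qed
qed

lemma small_energy_of_fibers:
  assumes "prime p" "finite A" "0 \<notin> A" "k > 0" "L > 0"
    and "\<And>i. i \<in> multiplicity p ` A \<Longrightarrow> small_energy k L (fiber p A i)"
  shows "small_energy k (4 * real k ^ 2 * L) A"
  unfolding small_energy_def
proof (intro allI impI)
  fix S assume S: "S \<subseteq> A"
  show "energy k S \<le> (4 * real k ^ 2 * L * card S) ^ k"
  proof (cases "S = {}")
    case True
    then show ?thesis using energy_empty assms(4) by simp
  next
    case False
    show ?thesis
    proof (rule energy_le_of_fibers[OF assms(1) _ False _ assms(4,5)])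
      show "finite S" "0 \<notin> S" using S assms(2,3) by (auto intro: finite_subset)
      fix i assume "i \<in> multiplicity p ` S"
      then have "i \<in> multiplicity p ` A" using S by auto
      moreover have "fiber p S i \<subseteq> fiber p A i" using S by (auto simp: fiber_def)
      ultimately show "energy k (fiber p S i) \<le> (L * card (fiber p S i)) ^ k"
        using assms(6) unfolding small_energy_def by blast
    qed
  qed
qed

definition structured_size :: "nat \<Rightarrow> real \<Rightarrow> nat set \<Rightarrow> real" where
  "structured_size k \<delta> A = real (Max (card ` {S. S \<subseteq> A \<and> small_energy k (card A powr \<delta>) S}))"

lemma structured_size_ge:
  assumes "finite A" "S \<subseteq> A" "small_energy k (card A powr \<delta>) S"
  shows "card S \<le> structured_size k \<delta> A"
  unfolding structured_size_def using assms by (intro of_nat_mono Max_ge) auto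

lemma structured_size_obtain:
  assumes "finite A" "A \<noteq> {}" "0 \<le> \<delta>" "k > 0"
  obtains S where "S \<subseteq> A" "small_energy k (card A powr \<delta>) S" "structured_size k \<delta> A = card S"
proof -
  obtain a where a: "a \<in> A" using assms by auto
  have "1 \<le> card A" using assms by (simp add: Suc_leI card_gt_0_iff)
  then have "small_energy k (card A powr \<delta>) {a}"
    using assms by (intro small_energy_singleton ge_one_powr_ge_zero) auto
  then have ne: "{S. S \<subseteq> A \<and> small_energy k (card A powr \<delta>) S} \<noteq> {}" using a by blast
  let ?C = "card ` {S. S \<subseteq> A \<and> small_energy k (card A powr \<delta>) S}"
  have "Max ?C \<in> ?C" using assms ne by (intro Max_in) auto
  then show ?thesis using that unfolding structured_size_def by fastforce
qed

text \<open>
  A fiber is light if it is smaller than \<open>A\<close> by the factor \<open>H\<close>. Uniting optimal subsets of the light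
  fibers multiplies the energy bound by \<open>4 * k\<^sup>2 = H powr \<delta>\<close>, which raises it to at most what is
  permitted for \<open>A\<close>. There are at most \<open>H\<close> other fibers, each of which has at most the size of \<open>A\<close>.
\<close>
lemma fiber_size_structured_size:
  fixes k :: nat and \<delta> s :: real
  defines "H \<equiv> (4 * real k ^ 2) powr (1 / \<delta>)"
  assumes k: "k > 0" and \<delta>: "\<delta> > 0" and s: "0 < s" "s \<le> 1/10" "(4 * (1 + H)) powr s \<le> 11/10"
  shows "fiber_size (structured_size k \<delta>) (1 + H) s"
proof
  let ?f = "structured_size k \<delta>"
  have k2: "1 \<le> 4 * real k ^ 2" using k by (simp add: Suc_leI self_le_power order_trans[of _ "real k ^ 2"])
  then have H1: "1 \<le> H" unfolding H_def using \<delta> by (intro ge_one_powr_ge_zero) auto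
  have Hd: "H powr \<delta> = 4 * real k ^ 2" unfolding H_def using \<delta> k by (simp add: powr_powr)
  have ge1: "1 \<le> ?f A" if A: "finite A" "A \<noteq> {}" for A
  proof -
    obtain a where a: "a \<in> A" using A by auto
    have "1 \<le> card A" using A by (simp add: Suc_leI card_gt_0_iff)
    then have "small_energy k (card A powr \<delta>) {a}"
      using k \<delta> by (intro small_energy_singleton ge_one_powr_ge_zero) auto
    then show ?thesis using structured_size_ge[OF A(1), of "{a}"] a by simp
  qed
  show "1 \<le> ?f {a}" for a by (rule ge1) auto
  show "0 < ?f A" if "finite A" "A \<noteq> {}" for A using ge1[OF that] by simp
  have fiber_le: "?f (fiber p A i) \<le> ?f A" if A: "finite A" and i: "i \<in> multiplicity p ` A" for p A i
  proof -
    have "finite (fiber p A i)" "fiber p A i \<noteq> {}" using A i by (auto simp: fiber_def)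
    then obtain S where S: "S \<subseteq> fiber p A i" "small_energy k (card (fiber p A i) powr \<delta>) S"
        "?f (fiber p A i) = card S"
      using structured_size_obtain \<delta> k by (metis less_imp_le)
    have "card (fiber p A i) \<le> card A" using A fiber_subset by (intro card_mono) auto
    then have "small_energy k (card A powr \<delta>) S"
      using \<delta> by (intro small_energy_mono[OF S(2)] powr_mono2) auto
    moreover have "S \<subseteq> A" using S fiber_subset by blast
    ultimately show ?thesis using structured_size_ge[OF A] S(3) by simp
  qed
  then show "?f (fiber p A i) \<le> ?f A" if "finite A" "i \<in> multiplicity p ` A" for p A i using that by blast
  show "(\<Sum>i\<in>multiplicity p ` A. ?f (fiber p A i)) \<le> (1 + H) * ?f A"
    if p: "prime p" and A: "finite A" "0 \<notin> A" for p A
  proof (cases "A = {}")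
    case True
    then show ?thesis using H1 by (simp add: structured_size_def)
  next
    case ne: False
    define I where "I = multiplicity p ` A"
    define c where "c = (\<lambda>i. real (card (fiber p A i)))"
    define light where "light = {i \<in> I. c i * H \<le> card A}"
    have finI: "finite I" unfolding I_def using A by simp
    have f1: "1 \<le> ?f A" using ge1 A ne by simp
    have cA: "card A > 0" using A ne by (simp add: card_gt_0_iff)
    have csum: "real (card A) = sum c I" unfolding c_def I_def using card_fibers[OF A(1), of p] by simp
    have heavy: "(\<Sum>i\<in>I - light. ?f (fiber p A i)) \<le> H * ?f A"
    proof -
      have "real (card (I - light)) * card A = (\<Sum>i\<in>I - light. real (card A))" by simp
      also have "\<dots> \<le> (\<Sum>i\<in>I - light. c i * H)" unfolding light_def by (intro sum_mono) auto
      also have "\<dots> \<le> (\<Sum>i\<in>I. c i * H)" using finI H1 by (intro sum_mono2) (auto simp: c_def)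
      also have "\<dots> = H * card A" unfolding csum by (simp add: sum_distrib_left mult.commute)
      finally have h: "real (card (I - light)) \<le> H" using cA by simp
      have "(\<Sum>i\<in>I - light. ?f (fiber p A i)) \<le> (\<Sum>i\<in>I - light. ?f A)"
        using fiber_le[OF A(1)] by (intro sum_mono) (auto simp: I_def)
      also have "\<dots> \<le> H * ?f A" using h f1 by (simp add: mult_right_mono)
      finally show ?thesis .
    qed
    have "(\<Sum>i\<in>light. ?f (fiber p A i)) \<le> ?f A"
    proof -
      have "\<exists>S. S \<subseteq> fiber p A i \<and> small_energy k (card (fiber p A i) powr \<delta>) S \<and> ?f (fiber p A i) = card S"
        if "i \<in> light" for i
      proof -
        have "finite (fiber p A i)" "fiber p A i \<noteq> {}" using A that by (auto simp: fiber_def light_def I_def)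
        then show ?thesis using structured_size_obtain \<delta> k by (metis less_imp_le)
      qed
      then obtain S where S: "\<And>i. i \<in> light \<Longrightarrow> S i \<subseteq> fiber p A i"
        "\<And>i. i \<in> light \<Longrightarrow> small_energy k (card (fiber p A i) powr \<delta>) (S i)"
        "\<And>i. i \<in> light \<Longrightarrow> ?f (fiber p A i) = card (S i)" by metis
      define U where "U = (\<Union>i\<in>light. S i)"
      define L where "L = card A powr \<delta> / (4 * real k ^ 2)"
      have L: "L > 0" unfolding L_def using cA k by simp
      have UA: "U \<subseteq> A" unfolding U_def using S(1) fiber_subset by blast
      have fibU: "fiber p U i = S i" if i: "i \<in> light" for i
      proof
        show "S i \<subseteq> fiber p U i" using S(1)[OF i] i unfolding U_def fiber_def by auto
        show "fiber p U i \<subseteq> S i" using S(1) unfolding U_def fiber_def by auto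
      qed
      have "small_energy k (4 * real k ^ 2 * L) U"
      proof (rule small_energy_of_fibers[OF p _ _ k L])
        show "finite U" "0 \<notin> U" using UA A by (auto intro: finite_subset)
        fix i assume "i \<in> multiplicity p ` U"
        then have i: "i \<in> light" using S(1) unfolding U_def fiber_def by auto
        have "c i \<le> card A / H" using i H1 unfolding light_def by (simp add: field_simps)
        then have "c i powr \<delta> \<le> (card A / H) powr \<delta>" using \<delta> unfolding c_def by (intro powr_mono2) auto
        also have "\<dots> = L" unfolding L_def Hd[symmetric] using H1 by (simp add: powr_divide)
        finally show "small_energy k L (fiber p U i)"
          unfolding fibU[OF i] c_def by (intro small_energy_mono[OF S(2)[OF i]]) auto
      qed
      then have "small_energy k (card A powr \<delta>) U" unfolding L_def using k by simp
      then have "card U \<le> ?f A" by (rule structured_size_ge[OF A(1) UA])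
      moreover have "real (card U) = (\<Sum>i\<in>light. ?f (fiber p A i))"
      proof -
        have "card U = (\<Sum>i\<in>light. card (S i))"
          unfolding U_def
        proof (rule card_UN_disjoint)
          show "finite light" unfolding light_def using finI by simp
          show "\<forall>i\<in>light. finite (S i)" using S(1) A finite_fiber finite_subset by metis
          show "\<forall>i\<in>light. \<forall>j\<in>light. i \<noteq> j \<longrightarrow> S i \<inter> S j = {}" 
          proof (intro ballI impI)
            fix i j assume "i \<in> light" "j \<in> light" "i \<noteq> j"
            then have "fiber p A i \<inter> fiber p A j = {}" "S i \<subseteq> fiber p A i" "S j \<subseteq> fiber p A j"
              using S(1) by (auto simp: fiber_def)
            then show "S i \<inter> S j = {}" by blast
          qed
        qed
        then show ?thesis using S(3) by simp
      qed
      ultimately show ?thesis by simp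
    qed
    moreover have "(\<Sum>i\<in>I. ?f (fiber p A i)) = (\<Sum>i\<in>I - light. ?f (fiber p A i)) + (\<Sum>i\<in>light. ?f (fiber p A i))"
      using finI by (intro sum.subset_diff) (auto simp: light_def)
    ultimately show ?thesis using heavy unfolding I_def by (simp add: algebra_simps)
  qed
  show "1 \<le> 1 + H" using H1 by simp
qed (use s in auto)

text \<open>
  For \<open>f = structured_size k \<delta>\<close> the inequality \<open>card (B * B) \<ge> w B\<close> reads
  \<open>(card B / f B) powr s \<le> card (B * B) / card B\<close>.
\<close>
lemma large_structured_subset:
  fixes k :: nat and \<delta> s K :: real
  assumes k: "k > 0" and \<delta>: "\<delta> > 0" and s: "0 < s" "s \<le> 1/10"
    and Hs: "(4 * (1 + (4 * real k ^ 2) powr (1 / \<delta>))) powr s \<le> 11/10"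
    and B: "finite B" "B \<noteq> {}" "0 \<notin> B" and K: "K > 0" "card (B * B) \<le> K * card B"
  obtains S where "S \<subseteq> B" "small_energy k (card B powr \<delta>) S" "card B * K powr (- 1 / s) \<le> card S"
proof -
  interpret fiber_size "structured_size k \<delta>" "1 + (4 * real k ^ 2) powr (1 / \<delta>)" s
    by (rule fiber_size_structured_size[OF k \<delta> s Hs])
  define F where "F = structured_size k \<delta> B"
  have F: "F > 0" unfolding F_def by (rule f_pos[OF B])
  have c: "real (card B) > 0" using B by (simp add: card_gt_0_iff)
  define P where "P = (\<Union>x\<in>B. prime_factors x)"
  have const: "multiplicity p x = multiplicity p y" if "prime p" "p \<notin> P" "x \<in> B" "y \<in> B" for p x y
  proof -
    have "multiplicity p z = 0" if "z \<in> B" for z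
      using that \<open>prime p\<close> \<open>p \<notin> P\<close> B(3)
      by (intro not_dvd_imp_multiplicity_0) (auto simp: P_def in_prime_factors_iff)
    then show ?thesis using that by simp
  qed
  have "sqrt (w B * w B) \<le> card (B * B)"
  proof (rule card_product_ge_weight[OF _ B B])
    show "finite P" unfolding P_def using B by simp
  qed (use const in blast)+
  then have "w B \<le> K * card B" using w_pos[OF B] K(2) by simp
  then have "(card B powr s * F powr - s) * card B \<le> K * card B"
    unfolding weight_def F_def using c by (simp add: powr_add mult_ac)
  then have "card B powr s * F powr - s \<le> K" by (rule mult_right_le_imp_le[OF _ c])
  then have "card B powr s \<le> K * F powr s" using F by (simp add: powr_minus field_simps)
  then have "(card B powr s) powr (1 / s) \<le> (K * F powr s) powr (1 / s)"
    using s by (intro powr_mono2) auto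
  then have "card B \<le> K powr (1 / s) * F" using s F c by (simp add: powr_mult powr_powr)
  then have "card B * K powr (- 1 / s) \<le> F"
    using K by (simp add: powr_minus field_simps)
  moreover obtain S where "S \<subseteq> B" "small_energy k (card B powr \<delta>) S" "F = card S"
    using structured_size_obtain[OF B(1,2) _ k] \<delta> unfolding F_def by (metis less_imp_le)
  ultimately show ?thesis using that by simp
qed

section \<open>From small energy to many sums\<close>

definition nat_sums :: "nat \<Rightarrow> nat set \<Rightarrow> nat set" where
  "nat_sums k S = (\<lambda>h. \<Sum>i<k. h i) ` PiE {..<k} (\<lambda>_. S)"

lemma finite_nat_sums: "finite S \<Longrightarrow> finite (nat_sums k S)"
  unfolding nat_sums_def by (intro finite_imageI finite_PiE) auto

text \<open>
  Cauchy-Schwarz for the number \<open>r t\<close> of representations of \<open>t\<close> as a sum: these numbers add up to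
  \<open>card S ^ k\<close>, and their squares to the energy.
\<close>
lemma card_power_le_sums_energy:
  assumes "finite S"
  shows "real (card S) ^ (2 * k) \<le> card (nat_sums k S) * real (energy k S)"
proof -
  define T where "T = PiE {..<k} (\<lambda>_. S)"
  define F where "F = (\<lambda>t. {h \<in> T. (\<Sum>i<k. h i) = t})"
  define r where "r = (\<lambda>t. real (card (F t)))"
  have finT: "finite T" unfolding T_def using assms by (intro finite_PiE) auto
  have finF: "finite (F t)" for t unfolding F_def using finT by simp
  have "real (card T) = sum r (nat_sums k S)"
  proof -
    have "card T = (\<Sum>t\<in>(\<lambda>h. \<Sum>i<k. h i) ` T. card (F t))"
      unfolding F_def card_eq_sum by (rule sum.image_gen[OF finT])
    then show ?thesis unfolding r_def nat_sums_def T_def by simp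
  qed
  moreover have "card T = card S ^ k" unfolding T_def using card_PiE[of "{..<k}" "\<lambda>_. S"] by simp
  ultimately have sum_r: "real (card S) ^ k = sum r (nat_sums k S)" by simp
  have "(\<Sum>t\<in>nat_sums k S. (r t)\<^sup>2) = card (SIGMA t:nat_sums k S. F t \<times> F t)"
    using finF finite_nat_sums[OF assms] by (subst card_SigmaI) (auto simp: r_def card_cartesian_product power2_eq_square)
  also have "card (SIGMA t:nat_sums k S. F t \<times> F t) \<le> energy k S"
  proof -
    \<comment> \<open>two halves are concatenated; outside of the index range the value is the one of extensional functions\<close>
    define glue where "glue = (\<lambda>(t::nat, h::nat \<Rightarrow> nat, h'::nat \<Rightarrow> nat) i. if i < k then h i else if i < 2 * k then h' (i - k) else undefined)"
    have "inj_on glue (SIGMA t:nat_sums k S. F t \<times> F t)"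
    proof (rule inj_onI, clarify)
      fix t h h' u g g'
      assume h: "h \<in> F t" "h' \<in> F t" and g: "g \<in> F u" "g' \<in> F u" and eq: "glue (t, h, h') = glue (u, g, g')"
      have "h i = g i" if "i < k" for i using fun_cong[OF eq, of i] that by (simp add: glue_def)
      moreover have "h' i = g' i" if "i < k" for i
        using fun_cong[OF eq, of "i + k"] that by (simp add: glue_def)
      ultimately have "h = g" "h' = g'"
        using h g PiE_ext[of h "{..<k}" "\<lambda>_. S" g] PiE_ext[of h' "{..<k}" "\<lambda>_. S" g']
        by (auto simp: F_def T_def)
      then show "t = u \<and> (h, h') = (g, g')" using h g by (auto simp: F_def)
    qed
    moreover have "glue ` (SIGMA t:nat_sums k S. F t \<times> F t) \<subseteq> solutions k (\<lambda>_. S)"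
    proof (clarify)
      fix t h h' assume h: "h \<in> F t" "h' \<in> F t"
      have split: "(\<Sum>i<2 * k. half_sign k i * int (glue (t, h, h') i))
          = (\<Sum>i<k. half_sign k i * int (glue (t, h, h') i)) + (\<Sum>i=0 + k..<k + k. half_sign k i * int (glue (t, h, h') i))"
        unfolding lessThan_atLeast0 by (simp add: sum.atLeastLessThan_concat mult_2)
      have "(\<Sum>i=0 + k..<k + k. half_sign k i * int (glue (t, h, h') i)) = (\<Sum>i<k. - int (h' i))"
        unfolding sum.shift_bounds_nat_ivl lessThan_atLeast0 by (rule sum.cong) (auto simp: half_sign_def glue_def)
      moreover have "(\<Sum>i<k. half_sign k i * int (glue (t, h, h') i)) = (\<Sum>i<k. int (h i))"
        by (rule sum.cong) (auto simp: half_sign_def glue_def)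
      moreover have "(\<Sum>i<k. int (h i)) = int t" "(\<Sum>i<k. int (h' i)) = int t"
        using h by (auto simp: F_def simp flip: of_nat_sum)
      ultimately have "(\<Sum>i<2 * k. half_sign k i * int (glue (t, h, h') i)) = 0"
        unfolding split by (simp add: sum_negf)
      moreover have "glue (t, h, h') \<in> PiE {..<2 * k} (\<lambda>_. S)"
        using h by (auto simp: F_def T_def glue_def PiE_iff extensional_def)
      ultimately show "glue (t, h, h') \<in> solutions k (\<lambda>_. S)" by (simp add: solutions_def)
    qed
    ultimately show ?thesis
      unfolding energy_def using finite_solutions[of "\<lambda>_. S" k] assms by (intro card_inj_on_le) auto
  qed
  finally have sq: "(\<Sum>t\<in>nat_sums k S. (r t)\<^sup>2) \<le> energy k S" by simp
  have "real (card S) ^ (2 * k) = (sum r (nat_sums k S))\<^sup>2"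
    unfolding sum_r[symmetric] by (simp add: power_mult mult.commute flip: power_mult)
  also have "\<dots> \<le> card (nat_sums k S) * (\<Sum>t\<in>nat_sums k S. (r t)\<^sup>2)"
    using sum_squared_le_sum_of_squares[of r "nat_sums k S"] by (simp add: mult.commute)
  also have "\<dots> \<le> card (nat_sums k S) * real (energy k S)" using sq by (intro mult_left_mono) auto
  finally show ?thesis .
qed

lemma card_nat_sums_ge:
  assumes "finite S" "S \<noteq> {}" "small_energy k L S" "L > 0"
  shows "(card S / L) ^ k \<le> card (nat_sums k S)"
proof -
  have c: "real (card S) > 0" using assms by (simp add: card_gt_0_iff)
  have "real (card S) ^ (2 * k) \<le> card (nat_sums k S) * real (energy k S)"
    by (rule card_power_le_sums_energy[OF assms(1)])
  also have "\<dots> \<le> card (nat_sums k S) * (L * card S) ^ k"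
    using assms(3) by (intro mult_left_mono) (auto simp: small_energy_def)
  finally have "(card S / L) ^ k * (L * card S) ^ k \<le> card (nat_sums k S) * (L * card S) ^ k"
    using assms(4) by (simp add: power_mult_distrib power_divide mult_2 power_add)
  then show ?thesis using c assms(4) by (simp add: mult_le_cancel_right)
qed

section \<open>Ratios and dilates\<close>

definition ratios :: "nat set \<Rightarrow> nat set \<Rightarrow> real set" where
  "ratios X Y = (\<lambda>(x, y). real x / real y) ` (X \<times> Y)"

lemma finite_ratios: "finite X \<Longrightarrow> finite Y \<Longrightarrow> finite (ratios X Y)"
  by (simp add: ratios_def)

text \<open>
  Ruzsa's triangle inequality: fix a representation \<open>r = n r / d r\<close> of each ratio; then
  \<open>(b * n r, b * d r)\<close> determines first \<open>r\<close> and then \<open>b\<close>.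
\<close>
lemma card_ratios_triangle:
  assumes B: "finite B" "0 \<notin> B"
  shows "card B * card (ratios B B) \<le> card (B * B) ^ 2"
proof -
  have "\<forall>r\<in>ratios B B. \<exists>x y. x \<in> B \<and> y \<in> B \<and> r = real x / real y" by (auto simp: ratios_def)
  then obtain n d where nd: "\<And>r. r \<in> ratios B B \<Longrightarrow> n r \<in> B \<and> d r \<in> B \<and> r = real (n r) / real (d r)"
    by metis
  define g where "g = (\<lambda>(b, r). (b * n r, b * d r))"
  have pos: "b > 0" if "b \<in> B" for b using that B by (metis gr0I)
  have "inj_on g (B \<times> ratios B B)"
  proof (rule inj_onI, clarify)
    fix b r b' r' assume b: "b \<in> B" "b' \<in> B" and r: "r \<in> ratios B B" "r' \<in> ratios B B"
      and eq: "g (b, r) = g (b', r')"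
    have e: "b * n r = b' * n r'" "b * d r = b' * d r'" using eq by (auto simp: g_def)
    have "r = real (b * n r) / real (b * d r)" using nd[OF r(1)] pos[OF b(1)] by simp
    also have "\<dots> = r'" unfolding e using nd[OF r(2)] pos[OF b(2)] by simp
    finally have rr: "r = r'" .
    have "0 < n r" using nd[OF r(1)] pos by blast
    then show "b = b' \<and> r = r'" using e(1) rr by simp
  qed
  moreover have "g ` (B \<times> ratios B B) \<subseteq> (B * B) \<times> (B * B)"
    using nd by (auto simp: g_def intro!: set_times_intro)
  ultimately have "card (B \<times> ratios B B) \<le> card ((B * B) \<times> (B * B))"
    using B by (intro card_inj_on_le) (auto intro: finite_set_times)
  then show ?thesis by (simp add: card_cartesian_product power2_eq_square)
qed

text \<open>
  The fibers of the quotient map on \<open>X \<times> Y\<close> have average size \<open>card X * card Y / card (ratios X Y)\<close>.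
\<close>
lemma popular_ratio:
  assumes X: "finite X" "X \<noteq> {}" "0 \<notin> X" and Y: "finite Y" "Y \<noteq> {}" "0 \<notin> Y"
  obtains r :: real where "r > 0" "real (card X) * card Y \<le> card (ratios X Y) * card {y \<in> Y. \<exists>x\<in>X. real x = r * y}"
proof -
  define q where "q = (\<lambda>(x, y). real x / real y)"
  define c where "c = (\<lambda>r::real. card {y \<in> Y. \<exists>x\<in>X. real x = r * y})"
  have finR: "finite (ratios X Y)" "ratios X Y \<noteq> {}" using X Y by (auto simp: finite_ratios) (auto simp: ratios_def)
  have fib: "card {z \<in> X \<times> Y. q z = r} \<le> c r" for r
    unfolding c_def
  proof (rule card_inj_on_le)
    have pos: "y > 0" if "y \<in> Y" for y using that Y by (metis gr0I)
    show "inj_on snd {z \<in> X \<times> Y. q z = r}"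
      using pos by (auto simp: inj_on_def q_def field_simps)
    show "snd ` {z \<in> X \<times> Y. q z = r} \<subseteq> {y \<in> Y. \<exists>x\<in>X. real x = r * y}"
      using pos by (force simp: q_def field_simps)
  qed (use Y in simp)
  define m where "m = Max (c ` ratios X Y)"
  have "m \<in> c ` ratios X Y" unfolding m_def using finR by (intro Max_in) auto
  then obtain r where r: "r \<in> ratios X Y" "m = c r" by blast
  have "card (X \<times> Y) = (\<Sum>r\<in>ratios X Y. card {z \<in> X \<times> Y. q z = r})"
    unfolding card_eq_sum ratios_def q_def[symmetric] by (rule sum.image_gen) (simp add: X Y)
  then have "card X * card Y = (\<Sum>r\<in>ratios X Y. card {z \<in> X \<times> Y. q z = r})"
    by (simp only: card_cartesian_product)
  also have "\<dots> \<le> (\<Sum>r\<in>ratios X Y. m)"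
    using finR by (intro sum_mono order_trans[OF fib]) (auto simp: m_def)
  finally have "card X * card Y \<le> card (ratios X Y) * c r" using r by simp
  then have "real (card X) * card Y \<le> card (ratios X Y) * c r" by (metis of_nat_le_iff of_nat_mult)
  moreover have "r > 0"
  proof -
    obtain x y where "x \<in> X" "y \<in> Y" "r = real x / real y" using r(1) by (auto simp: ratios_def)
    moreover from this have "x > 0" "y > 0" using X(3) Y(3) by (metis gr0I)+
    ultimately show ?thesis by simp
  qed
  ultimately show ?thesis unfolding c_def by (intro that[of r])
qed

lemma card_nat_sums_dilate:
  fixes r :: real
  assumes A: "finite A" and r: "r > 0" and sub: "\<And>y. y \<in> Y \<Longrightarrow> \<exists>x\<in>A. real x = r * real y"
  shows "card (nat_sums k Y) \<le> card (nat_sums k A)"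
proof -
  obtain x where x: "\<And>y. y \<in> Y \<Longrightarrow> x y \<in> A \<and> real (x y) = r * real y" using sub by metis
  have "(\<lambda>t. r * real t) ` nat_sums k Y \<subseteq> real ` nat_sums k A"
  proof
    fix u assume "u \<in> (\<lambda>t. r * real t) ` nat_sums k Y"
    then obtain h where h: "h \<in> PiE {..<k} (\<lambda>_. Y)" "u = r * real (\<Sum>i<k. h i)" by (auto simp: nat_sums_def)
    have "u = (\<Sum>i<k. real (restrict (\<lambda>i. x (h i)) {..<k} i))"
      using h x by (auto simp: sum_distrib_left PiE_iff intro!: sum.cong)
    also have "\<dots> = real (\<Sum>i<k. restrict (\<lambda>i. x (h i)) {..<k} i)" by simp
    finally have "u = real (\<Sum>i<k. restrict (\<lambda>i. x (h i)) {..<k} i)" .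
    moreover have "restrict (\<lambda>i. x (h i)) {..<k} \<in> PiE {..<k} (\<lambda>_. A)" using h x by (auto simp: PiE_iff)
    ultimately show "u \<in> real ` nat_sums k A" unfolding nat_sums_def by blast
  qed
  then have "card ((\<lambda>t. r * real t) ` nat_sums k Y) \<le> card (real ` nat_sums k A)"
    using finite_nat_sums[OF A] by (intro card_mono) auto
  moreover have "card ((\<lambda>t. r * real t) ` nat_sums k Y) = card (nat_sums k Y)"
    using r by (intro card_image) (auto simp: inj_on_def)
  moreover have "card (real ` nat_sums k A) = card (nat_sums k A)"
    by (intro card_image) (auto simp: inj_on_def)
  ultimately show ?thesis by simp
qed

lemma nat_set_power:
  fixes A :: "nat set"
  assumes "finite A" "A \<noteq> {}" "0 \<notin> A"
  shows "finite (A ^ m)" "A ^ m \<noteq> {}" "0 \<notin> A ^ m"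
proof -
  have "finite (A ^ m) \<and> A ^ m \<noteq> {} \<and> 0 \<notin> A ^ m"
    using assms by (induction m) (auto simp: set_one intro: finite_set_times elim!: set_times_elim)
  then show "finite (A ^ m)" "A ^ m \<noteq> {}" "0 \<notin> A ^ m" by auto
qed

lemma card_le_card_product:
  fixes X Y :: "nat set"
  assumes "finite X" "finite Y" "Y \<noteq> {}" "0 \<notin> Y"
  shows "card X \<le> card (X * Y)"
proof -
  obtain y where y: "y \<in> Y" "y > 0" using assms by (metis all_not_in_conv gr0I)
  have "(\<lambda>x. x * y) ` X \<subseteq> X * Y" using y by (auto intro: set_times_intro)
  moreover have "inj_on (\<lambda>x. x * y) X" using y by (auto simp: inj_on_def)
  ultimately show ?thesis using assms by (intro card_inj_on_le) (auto intro: finite_set_times)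
qed

lemma card_nat_set_power_mono:
  fixes A :: "nat set"
  assumes "finite A" "A \<noteq> {}" "0 \<notin> A" "m \<le> n"
  shows "card (A ^ m) \<le> card (A ^ n)"
proof -
  have "A ^ n = A ^ m * A ^ (n - m)" using assms(4) by (simp flip: power_add)
  then show ?thesis using nat_set_power[OF assms(1-3)] card_le_card_product[of "A ^ m" "A ^ (n - m)"] by simp
qed

text \<open>
  Multiplication by a fixed element of \<open>A ^ m\<close> moves \<open>A\<close> into \<open>A ^ Suc m\<close>.
\<close>
lemma card_ratios_le:
  assumes A: "finite A" "A \<noteq> {}" "0 \<notin> A" and S: "S \<subseteq> A ^ Suc m"
  shows "card (ratios A S) \<le> card (ratios (A ^ Suc m) (A ^ Suc m))"
proof -
  obtain c where c: "c \<in> A ^ m" "c > 0" using nat_set_power[OF A, of m] by (metis all_not_in_conv gr0I)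
  have "(\<lambda>r. real c * r) ` ratios A S \<subseteq> ratios (A ^ Suc m) (A ^ Suc m)"
  proof
    fix u assume "u \<in> (\<lambda>r. real c * r) ` ratios A S"
    then obtain a y where ay: "a \<in> A" "y \<in> S" "u = real c * (real a / real y)" by (auto simp: ratios_def)
    have "a * c \<in> A ^ Suc m" "y \<in> A ^ Suc m" using ay c S by (auto intro: set_times_intro)
    moreover have "u = real (a * c) / real y" using ay by simp
    ultimately show "u \<in> ratios (A ^ Suc m) (A ^ Suc m)" unfolding ratios_def by force
  qed
  moreover have "inj_on (\<lambda>r. real c * r) (ratios A S)" using c by (auto simp: inj_on_def)
  moreover have "finite (ratios (A ^ Suc m) (A ^ Suc m))" by (rule finite_ratios[OF nat_set_power(1)[OF A] nat_set_power(1)[OF A]])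
  ultimately show ?thesis by (intro card_inj_on_le)
qed

section \<open>Sums and products of positive integers\<close>

text \<open>
  The parameters: \<open>\<delta>\<close> makes the energy bound \<open>L\<close> at most \<open>N powr (1/4)\<close>, since \<open>B\<close> has at most
  \<open>N ^ b\<close> elements; \<open>J\<close> is so large that the dilate of \<open>S\<close> meets \<open>A\<close> in at least \<open>N powr (3/4)\<close> elements.
  A set of this size with this energy bound has at least \<open>N powr (k / 2)\<close> sums, and
  \<open>k / 2 > b\<close>.
\<close>
theorem sum_product_nat:
  fixes b :: nat
  assumes b: "b > 0"
  obtains k m :: nat where "k > 0" "m > 0"
    "\<And>A :: nat set. \<lbrakk>finite A; 0 \<notin> A; 2 \<le> card A\<rbrakk> \<Longrightarrow>
       card A ^ b < card (nat_sums k A) \<or> card A ^ b < card (A ^ m)"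
proof -
  define k where "k = 2 * b + 1"
  define \<delta> where "\<delta> = 1 / (4 * real b)"
  define H where "H = (4 * real k ^ 2) powr (1 / \<delta>)"
  define s where "s = min (1/10) (ln (11/10) / ln (4 * (1 + H)))"
  have k: "k > 0" unfolding k_def by simp
  have \<delta>: "\<delta> > 0" unfolding \<delta>_def using b by simp
  have H0: "H \<ge> 0" unfolding H_def by simp
  then have lnH: "ln (4 * (1 + H)) > 0" by (simp add: ln_gt_zero)
  have "s \<le> 1/10" unfolding s_def by (rule min.cobounded1)
  moreover have "0 < s" unfolding s_def using lnH by simp
  ultimately have s: "0 < s" "s \<le> 1/10" by auto
  have "s \<le> ln (11/10) / ln (4 * (1 + H))" unfolding s_def by simp
  then have "s * ln (4 * (1 + H)) \<le> ln (11/10)" using lnH by (simp add: pos_le_divide_eq)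
  then have "exp (s * ln (4 * (1 + H))) \<le> exp (ln (11/10))" by (simp only: exp_le_cancel_iff)
  then have Hs: "(4 * (1 + H)) powr s \<le> 11/10" using H0 by (simp add: powr_def)
  define J where "J = nat \<lceil>4 * real b * (1 / s + 2)\<rceil> + 1"
  have J: "J > 0" "4 * real b * (1 / s + 2) \<le> J" unfolding J_def by linarith+
  define m :: nat where "m = 2 ^ J"
  have "card A ^ b < card (nat_sums k A)"
    if A: "finite A" "0 \<notin> A" "2 \<le> card A" and small: "card (A ^ m) \<le> card A ^ b" for A :: "nat set"
  proof -
    have ne: "A \<noteq> {}" using A by auto
    note A' = A(1) ne A(2)
    define N where "N = real (card A)"
    have N: "N \<ge> 2" unfolding N_def using A by simp
    define K where "K = N powr (b / J)"
    have K: "K > 0" unfolding K_def using N by simp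
    have KJ: "K ^ J = N ^ b" unfolding K_def using N J b by (simp add: powr_power powr_realpow)
    \<comment> \<open>otherwise the sizes grow from \<open>N\<close> to more than \<open>N * K ^ J = N ^ (b + 1)\<close>\<close>
    have "\<exists>j<J. card (A ^ (2 ^ Suc j)) \<le> K * card (A ^ (2 ^ j))"
    proof (rule ccontr)
      assume c: "\<not> ?thesis"
      have "j \<le> J \<Longrightarrow> N * K ^ j \<le> card (A ^ (2 ^ j))" for j
      proof (induction j)
        case (Suc j)
        have "N * K ^ Suc j \<le> K * card (A ^ (2 ^ j))" using Suc K by (simp add: mult.left_commute)
        also have "\<dots> \<le> card (A ^ (2 ^ Suc j))" using c Suc.prems by (metis Suc_le_lessD linear)
        finally show ?case .
      qed (simp only: N_def power_0 power_one_right mult_1_right order_refl)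
      from this[of J] have "N * N ^ b \<le> card (A ^ m)" unfolding KJ m_def by simp
      also have "\<dots> \<le> N ^ b" using small unfolding N_def by (simp flip: of_nat_power)
      finally show False using N by simp
    qed
    then obtain j where j: "j < J" "card (A ^ (2 ^ Suc j)) \<le> K * card (A ^ (2 ^ j))" by blast
    define B where "B = A ^ (2 ^ j)"
    note B = nat_set_power[OF A', of "2 ^ j", folded B_def]
    have BB: "card (B * B) \<le> K * card B" using j(2) unfolding B_def by (simp add: mult_2 flip: power_add)
    have cB: "real (card B) > 0" using B by (simp add: card_gt_0_iff)
    have BN: "card B \<le> N ^ b"
    proof -
      have "(2::nat) ^ j \<le> m" unfolding m_def using j by (intro power_increasing) auto
      then have "card B \<le> card A ^ b"
        unfolding B_def using small card_nat_set_power_mono[OF A'] order_trans by blast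
      then show ?thesis unfolding N_def by (simp flip: of_nat_power)
    qed
    obtain S where S: "S \<subseteq> B" "small_energy k (card B powr \<delta>) S" "card B * K powr (- 1 / s) \<le> card S"
      using large_structured_subset[OF k \<delta> s Hs[unfolded H_def] B K BB] by blast
    have "0 < card B * K powr (- 1 / s)" using cB K by simp
    then have "0 < real (card S)" using S(3) by linarith
    then have S': "finite S" "S \<noteq> {}" "0 \<notin> S" using S(1) B by (auto intro: card_ge_0_finite)
    obtain m' where m': "(2::nat) ^ j = Suc m'" by (metis not0_implies_Suc power_not_zero zero_neq_numeral)
    have R: "card (ratios A S) \<le> K\<^sup>2 * card B"
    proof -
      have "card (ratios A S) \<le> card (ratios B B)"
        using card_ratios_le[OF A', of S m'] S(1) unfolding B_def m' by simp
      then have "real (card B) * card (ratios A S) \<le> real (card B) * card (ratios B B)"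
        by (intro mult_left_mono of_nat_mono) auto
      also have "\<dots> \<le> real (card (B * B)) ^ 2"
        using card_ratios_triangle[OF B(1,3)] by (metis of_nat_le_iff of_nat_mult of_nat_power)
      also have "\<dots> \<le> (K * card B) ^ 2" using BB by (intro power_mono) auto
      also have "\<dots> = real (card B) * (K\<^sup>2 * card B)" by (simp add: power2_eq_square)
      finally show ?thesis using cB by (simp only: mult_le_cancel_left_pos)
    qed
    obtain r :: real where r: "r > 0"
      "real (card A) * card S \<le> card (ratios A S) * card {y \<in> S. \<exists>x\<in>A. real x = r * y}"
      using popular_ratio[OF A' S'] by blast
    define T where "T = {y \<in> S. \<exists>x\<in>A. real x = r * y}"
    have "card B * (N * K powr (- 1 / s)) \<le> N * card S"
      using S(3) N mult_left_mono[of "card B * K powr (- 1 / s)" "card S" N] by (simp add: mult_ac)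
    also have "\<dots> \<le> real (card (ratios A S)) * card T" using r(2) unfolding N_def T_def by simp
    also have "\<dots> \<le> (K\<^sup>2 * card B) * card T" using R by (intro mult_right_mono) auto
    finally have "card B * (N * K powr (- 1 / s)) \<le> card B * (K\<^sup>2 * card T)" by (simp add: mult_ac)
    then have "N * K powr (- 1 / s) \<le> K\<^sup>2 * card T" using cB by (simp only: mult_le_cancel_left_pos)
    then have "N * K powr (- 1 / s) * K powr - 2 \<le> K\<^sup>2 * card T * K powr - 2" by (intro mult_right_mono) auto
    also have "K\<^sup>2 * card T * K powr - 2 = card T" using K by (simp add: powr_minus powr_numeral)
    finally have "N * K powr (- 1 / s) * K powr - 2 \<le> card T" .
    also have "N * K powr (- 1 / s) * K powr - 2 = N powr (1 - b / J * (1 / s + 2))"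
    proof -
      have "N * K powr (- 1 / s) * K powr - 2 = N powr 1 * N powr (b / J * (- 1 / s)) * N powr (b / J * - 2)"
        unfolding K_def using N by (simp only: powr_powr powr_one)
      also have "\<dots> = N powr (1 + b / J * (- 1 / s) + b / J * - 2)" by (simp only: powr_add)
      also have "1 + b / J * (- 1 / s) + b / J * - 2 = 1 - b / J * (1 / s + 2)" by (simp add: algebra_simps)
      finally show ?thesis .
    qed
    finally have "N powr (1 - b / J * (1 / s + 2)) \<le> card T" .
    moreover have "N powr (3/4) \<le> N powr (1 - b / J * (1 / s + 2))"
      using J N by (intro powr_mono) (auto simp: field_simps)
    ultimately have T: "N powr (3/4) \<le> card T" by simp
    then have "0 < real (card T)" using N by (smt (verit) powr_gt_zero)
    then have T': "finite T" "T \<noteq> {}" by (auto intro: card_ge_0_finite)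
    define L where "L = card B powr \<delta>"
    have L: "L > 0" unfolding L_def using cB by simp
    have "L \<le> (N ^ b) powr \<delta>" unfolding L_def using BN \<delta> by (intro powr_mono2) auto
    also have "\<dots> = N powr (1/4)"
      unfolding \<delta>_def using N b by (simp add: powr_powr flip: powr_realpow)
    finally have LN: "L \<le> N powr (1/4)" .
    have "N ^ b = N powr b" using N by (simp add: powr_realpow)
    also have "\<dots> < N powr (1/2 * k)" using N unfolding k_def by (intro powr_less_mono) auto
    also have "\<dots> = (N powr (1/2)) ^ k" using N by (simp add: powr_power)
    also have "N powr (1/2) = N powr (3/4) / N powr (1/4)" by (simp flip: powr_diff)
    also have "(N powr (3/4) / N powr (1/4)) ^ k \<le> (card T / L) ^ k"
      using T LN L N by (intro power_mono frac_le) auto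
    also have "\<dots> \<le> card (nat_sums k T)"
      using small_energy_subset[OF S(2), of T] L unfolding L_def
      by (intro card_nat_sums_ge[OF T']) (auto simp: T_def)
    also have "\<dots> \<le> card (nat_sums k A)"
      using card_nat_sums_dilate[OF A(1) r(1), of T k] by (auto simp: T_def)
    finally show ?thesis unfolding N_def by (simp flip: of_nat_power)
  qed
  then show ?thesis using that[of k m] k unfolding m_def by (meson linorder_not_le zero_less_numeral zero_less_power)
qed

section \<open>Sums and products of integers\<close>

lemma kfold_sumset_iff:
  "x \<in> kfold_sumset k A \<longleftrightarrow> (\<exists>a. (\<forall>i<k. a i \<in> A) \<and> x = (\<Sum>i<k. a i))"
  by (auto simp: kfold_sumset_def)

lemma kfold_prodset_iff:
  "x \<in> kfold_prodset k A \<longleftrightarrow> (\<exists>a. (\<forall>i<k. a i \<in> A) \<and> x = (\<Prod>i<k. a i))"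
  by (auto simp: kfold_prodset_def)

lemma finite_kfold:
  assumes "finite A"
  shows "finite (kfold_sumset k A)" "finite (kfold_prodset k A)"
proof -
  let ?T = "PiE {..<k} (\<lambda>_. A)"
  have T: "finite ?T" using assms by (intro finite_PiE) auto
  have "kfold_sumset k A \<subseteq> (\<lambda>h. \<Sum>i<k. h i) ` ?T"
  proof
    fix x assume "x \<in> kfold_sumset k A"
    then obtain a where a: "\<forall>i<k. a i \<in> A" "x = (\<Sum>i<k. a i)" unfolding kfold_sumset_iff by blast
    then show "x \<in> (\<lambda>h. \<Sum>i<k. h i) ` ?T" by (intro image_eqI[of _ _ "restrict a {..<k}"]) auto
  qed
  then show "finite (kfold_sumset k A)" using T finite_subset by blast
  have "kfold_prodset k A \<subseteq> (\<lambda>h. \<Prod>i<k. h i) ` ?T"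
  proof
    fix x assume "x \<in> kfold_prodset k A"
    then obtain a where a: "\<forall>i<k. a i \<in> A" "x = (\<Prod>i<k. a i)" unfolding kfold_prodset_iff by blast
    then show "x \<in> (\<lambda>h. \<Prod>i<k. h i) ` ?T" by (intro image_eqI[of _ _ "restrict a {..<k}"]) auto
  qed
  then show "finite (kfold_prodset k A)" using T finite_subset by blast
qed

lemma card_kfold_sumset_mono:
  assumes A: "finite A" "a0 \<in> A" and "k \<le> l"
  shows "card (kfold_sumset k A) \<le> card (kfold_sumset l A)"
proof (rule lift_Suc_mono_le[OF _ assms(3)])
  fix k
  have "(\<lambda>x. x + a0) ` kfold_sumset k A \<subseteq> kfold_sumset (Suc k) A"
  proof
    fix y assume "y \<in> (\<lambda>x. x + a0) ` kfold_sumset k A"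
    then obtain a where a: "\<forall>i<k. a i \<in> A" "y = (\<Sum>i<k. a i) + a0" by (auto simp: kfold_sumset_iff)
    then show "y \<in> kfold_sumset (Suc k) A"
      unfolding kfold_sumset_iff using A(2) by (intro exI[of _ "a(k := a0)"]) auto
  qed
  then show "card (kfold_sumset k A) \<le> card (kfold_sumset (Suc k) A)"
    using finite_kfold[OF A(1)] by (intro card_inj_on_le[of "\<lambda>x. x + a0"]) auto
qed

lemma card_kfold_prodset_mono:
  assumes A: "finite A" "a0 \<in> A" "a0 \<noteq> 0" and "k \<le> l"
  shows "card (kfold_prodset k A) \<le> card (kfold_prodset l A)"
proof (rule lift_Suc_mono_le[OF _ assms(4)])
  fix k
  have "(\<lambda>x. x * a0) ` kfold_prodset k A \<subseteq> kfold_prodset (Suc k) A"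
  proof
    fix y assume "y \<in> (\<lambda>x. x * a0) ` kfold_prodset k A"
    then obtain a where a: "\<forall>i<k. a i \<in> A" "y = (\<Prod>i<k. a i) * a0" by (auto simp: kfold_prodset_iff)
    then show "y \<in> kfold_prodset (Suc k) A"
      unfolding kfold_prodset_iff using A(2) by (intro exI[of _ "a(k := a0)"]) auto
  qed
  then show "card (kfold_prodset k A) \<le> card (kfold_prodset (Suc k) A)"
    using finite_kfold[OF A(1)] A(3) by (intro card_inj_on_le[of "\<lambda>x. x * a0"]) (auto simp: inj_on_def)
qed

text \<open>
  The sums of \<open>j\<close> copies of \<open>c\<close> and \<open>k - j\<close> copies of \<open>a\<close> are distinct.
\<close>
lemma card_kfold_sumset_gt:
  assumes A: "finite A" "a \<in> A" "c \<in> A" "a \<noteq> c"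
  shows "k < card (kfold_sumset k A)"
proof -
  define g where "g = (\<lambda>j::nat. int j * c + int (k - j) * a)"
  have "g ` {..k} \<subseteq> kfold_sumset k A"
  proof
    fix x assume "x \<in> g ` {..k}"
    then obtain j where j: "j \<le> k" "x = g j" by auto
    have "(\<Sum>i<k. if i < j then c else a) = (\<Sum>i\<in>{..<k} \<inter> {i. i < j}. c) + (\<Sum>i\<in>{..<k} \<inter> - {i. i < j}. a)"
      by (rule sum.If_cases) simp
    also have "{..<k} \<inter> {i. i < j} = {..<j}" using j by auto
    also have "{..<k} \<inter> - {i. i < j} = {j..<k}" by auto
    finally have "x = (\<Sum>i<k. if i < j then c else a)" using j by (simp add: g_def)
    then show "x \<in> kfold_sumset k A"
      unfolding kfold_sumset_iff using A by (intro exI[of _ "\<lambda>i. if i < j then c else a"]) auto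
  qed
  moreover have "inj_on g {..k}"
  proof (rule inj_onI)
    fix i j assume ij: "i \<in> {..k}" "j \<in> {..k}" "g i = g j"
    then have "(int i - int j) * (c - a) = 0" by (simp add: g_def of_nat_diff algebra_simps)
    then show "i = j" using A(4) by simp
  qed
  ultimately have "card {..k} \<le> card (kfold_sumset k A)" using finite_kfold[OF A(1)] by (intro card_inj_on_le)
  then show ?thesis by simp
qed

lemma nat_set_power_elem:
  fixes X :: "nat set"
  assumes "t \<in> X ^ m"
  obtains h where "\<forall>i<m. h i \<in> X" "t = (\<Prod>i<m. h i)"
proof -
  have "\<exists>h. (\<forall>i<m. h i \<in> X) \<and> t = (\<Prod>i<m. h i)"
    using assms
  proof (induction m arbitrary: t)
    case (Suc m)
    obtain x y where xy: "x \<in> X" "y \<in> X ^ m" "t = x * y" using Suc.prems by (auto elim!: set_times_elim)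
    then obtain h where "\<forall>i<m. h i \<in> X" "y = (\<Prod>i<m. h i)" using Suc.IH by blast
    then show ?case using xy by (intro exI[of _ "h(m := x)"]) auto
  qed (simp add: set_one)
  then show ?thesis using that by blast
qed

lemma card_kfold_ge_nat:
  fixes X :: "nat set" and e :: int
  assumes A: "finite A" and e: "e = 1 \<or> e = - 1" and X: "\<And>x. x \<in> X \<Longrightarrow> e * int x \<in> A"
  shows "card (nat_sums k X) \<le> card (kfold_sumset k A)"
    and "card (X ^ m) \<le> card (kfold_prodset m A)"
proof -
  have "(\<lambda>t. e * int t) ` nat_sums k X \<subseteq> kfold_sumset k A"
  proof
    fix u assume "u \<in> (\<lambda>t. e * int t) ` nat_sums k X"
    then obtain h where h: "h \<in> PiE {..<k} (\<lambda>_. X)" "u = e * int (\<Sum>i<k. h i)" by (auto simp: nat_sums_def)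
    then show "u \<in> kfold_sumset k A"
      unfolding kfold_sumset_iff using X
      by (intro exI[of _ "\<lambda>i. e * int (h i)"]) (auto simp: sum_distrib_left PiE_iff)
  qed
  then show "card (nat_sums k X) \<le> card (kfold_sumset k A)"
    using finite_kfold[OF A] e by (intro card_inj_on_le[of "\<lambda>t. e * int t"]) (auto simp: inj_on_def)
  have "(\<lambda>t. e ^ m * int t) ` (X ^ m) \<subseteq> kfold_prodset m A"
  proof
    fix u assume "u \<in> (\<lambda>t. e ^ m * int t) ` (X ^ m)"
    then obtain t where t: "t \<in> X ^ m" "u = e ^ m * int t" by auto
    obtain h where h: "\<forall>i<m. h i \<in> X" "t = (\<Prod>i<m. h i)" using nat_set_power_elem[OF t(1)] by blast
    have "u = (\<Prod>i<m. e * int (h i))" unfolding t(2) h(2) by (simp add: prod.distrib)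
    then show "u \<in> kfold_prodset m A"
      unfolding kfold_prodset_iff using X h(1) by (intro exI[of _ "\<lambda>i. e * int (h i)"]) auto
  qed
  moreover have "e ^ m \<noteq> 0" using e by auto
  ultimately show "card (X ^ m) \<le> card (kfold_prodset m A)"
    using finite_kfold[OF A] by (intro card_inj_on_le[of "\<lambda>t. e ^ m * int t"]) (auto simp: inj_on_def)
qed

lemma signed_half:
  fixes A :: "int set"
  assumes A: "finite A"
  obtains e :: int and X :: "nat set" where "e = 1 \<or> e = - 1" "finite X" "0 \<notin> X"
    "\<And>x. x \<in> X \<Longrightarrow> e * int x \<in> A" "card A \<le> 2 * card X + 1"
proof -
  define X where "X = (\<lambda>e::int. {x::nat. x > 0 \<and> e * int x \<in> A})"
  have fin: "finite (X e)" if "e = 1 \<or> e = - 1" for e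
  proof -
    have "inj_on (\<lambda>x. e * int x) (X e)" using that by (auto simp: inj_on_def)
    moreover have "(\<lambda>x. e * int x) ` X e \<subseteq> A" by (auto simp: X_def)
    ultimately show ?thesis using A by (metis finite_imageD finite_subset)
  qed
  have "A \<subseteq> insert 0 (int ` X 1 \<union> (\<lambda>x. - int x) ` X (- 1))"
  proof
    fix a assume a: "a \<in> A"
    consider "a = 0" | "a > 0" | "a < 0" by linarith
    then show "a \<in> insert 0 (int ` X 1 \<union> (\<lambda>x. - int x) ` X (- 1))"
    proof cases
      case 2
      then have "a = int (nat a)" "nat a \<in> X 1" using a by (auto simp: X_def)
      then show ?thesis by blast
    next
      case 3
      then have "a = - int (nat (- a))" "nat (- a) \<in> X (- 1)" using a by (auto simp: X_def)
      then show ?thesis by blast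
    qed simp
  qed
  then have "card A \<le> card (insert 0 (int ` X 1 \<union> (\<lambda>x. - int x) ` X (- 1)))"
    using fin by (intro card_mono) auto
  also have "\<dots> \<le> Suc (card (int ` X 1 \<union> (\<lambda>x. - int x) ` X (- 1)))" by (rule card_insert_le_m1) auto
  also have "\<dots> \<le> Suc (card (int ` X 1) + card ((\<lambda>x. - int x) ` X (- 1)))" using card_Un_le by simp
  also have "\<dots> \<le> Suc (card (X 1) + card (X (- 1)))"
    using card_image_le[OF fin[of 1], of int] card_image_le[OF fin[of "- 1"], of "\<lambda>x. - int x"] by simp
  finally have c: "card A \<le> Suc (card (X 1) + card (X (- 1)))" .
  show ?thesis
  proof (cases "card (X (- 1)) \<le> card (X 1)")
    case True
    show ?thesis by (rule that[of 1 "X 1"]) (use fin[of 1] c True in \<open>auto simp: X_def\<close>)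
  next
    case False
    show ?thesis by (rule that[of "- 1" "X (- 1)"]) (use fin[of "- 1"] c False in \<open>auto simp: X_def\<close>)
  qed
qed

text \<open>
  The positive elements of \<open>A\<close>, or the negatives of the negative ones, form a set \<open>X\<close> with
  \<open>card A \<le> 2 * card X + 1\<close>. If \<open>X\<close> has two elements, then \<open>card A \<le> card X ^ 3\<close>, so the result for
  positive integers with exponent \<open>3 * b\<close> applies. Otherwise \<open>card A \<le> 3\<close>, and the trivial bound of more than
  \<open>l\<close> sums suffices for \<open>l \<ge> 3 ^ b\<close>.
\<close>
theorem mainTheorem1:
  fixes b :: nat
  assumes "b > 0"
  shows "\<exists>k::nat. k > 0 \<and>
    (\<forall>A :: int set. finite A \<and> card A \<ge> 2 \<longrightarrow>
      card (kfold_sumset k A) > card A ^ b \<or> card (kfold_prodset k A) > card A ^ b)"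
proof -
  have "3 * b > 0" using assms by simp
  then obtain k m where k: "k > 0" and km: "\<And>A :: nat set. \<lbrakk>finite A; 0 \<notin> A; 2 \<le> card A\<rbrakk> \<Longrightarrow>
       card A ^ (3 * b) < card (nat_sums k A) \<or> card A ^ (3 * b) < card (A ^ m)"
    using sum_product_nat by metis
  define l where "l = max (max k m) (3 ^ b)"
  have l: "k \<le> l" "m \<le> l" "3 ^ b \<le> l" unfolding l_def by auto
  have "card A ^ b < card (kfold_sumset l A) \<or> card A ^ b < card (kfold_prodset l A)"
    if A: "finite A" "2 \<le> card A" for A :: "int set"
  proof -
    obtain a c where ac: "a \<in> A" "c \<in> A" "a \<noteq> c"
      using A(2) by (metis card_le_Suc0_iff_eq A(1) not_less_eq_eq numeral_2_eq_2)
    obtain e X where X: "e = 1 \<or> e = - 1" "finite X" "0 \<notin> X" "\<And>x. x \<in> X \<Longrightarrow> e * int x \<in> A"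
        "card A \<le> 2 * card X + 1"
      using signed_half[OF A(1)] by blast
    show ?thesis
    proof (cases "2 \<le> card X")
      case True
      obtain x where x: "x \<in> X" using True by fastforce
      moreover have "x \<noteq> 0" using x X(3) by metis
      ultimately have x': "e * int x \<in> A" "e * int x \<noteq> 0" using X(1,4) by auto
      have "2 * card X + 1 \<le> card X ^ 3"
      proof -
        have "2 * 2 \<le> card X * card X" using True by (intro mult_le_mono)
        then have "4 * card X \<le> card X * card X * card X" by (intro mult_le_mono1) simp
        then show ?thesis unfolding power3_eq_cube using True by linarith
      qed
      then have "card A ^ b \<le> (card X ^ 3) ^ b" using X(5) by (intro power_mono) auto
      then have le: "card A ^ b \<le> card X ^ (3 * b)" by (simp add: power_mult)
      from km[OF X(2,3) True] show ?thesis
      proof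
        assume "card X ^ (3 * b) < card (nat_sums k X)"
        also have "\<dots> \<le> card (kfold_sumset k A)" by (rule card_kfold_ge_nat(1)[OF A(1) X(1,4)])
        also have "\<dots> \<le> card (kfold_sumset l A)" by (rule card_kfold_sumset_mono[OF A(1) ac(1) l(1)])
        finally show ?thesis using le by simp
      next
        assume "card X ^ (3 * b) < card (X ^ m)"
        also have "\<dots> \<le> card (kfold_prodset m A)" by (rule card_kfold_ge_nat(2)[OF A(1) X(1,4)])
        also have "\<dots> \<le> card (kfold_prodset l A)" by (rule card_kfold_prodset_mono[OF A(1) x' l(2)])
        finally show ?thesis using le by simp
      qed
    next
      case False
      then have "card A ^ b \<le> 3 ^ b" using X(5) by (intro power_mono) auto
      also have "\<dots> \<le> l" by (rule l(3))
      also have "\<dots> < card (kfold_sumset l A)" by (rule card_kfold_sumset_gt[OF A(1) ac])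
      finally show ?thesis by simp
    qed
  qed
  moreover have "l > 0" using k l by simp
  ultimately show ?thesis by blast
qed

end
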